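(* (Roos product bound) Let $\mathbb E,\mathbb F,\mathbb K,\mathbb L,\sigma,\theta,m,\ell$ be as in the context. Let $\mathcal C_1\subseteq\mathbb F^\ell$ be a nonzero cyclic code with minimum Hamming distance $\mathrm d_{\mathrm H}$ whose generator polynomial belongs to $\mathbb E[x]$, and let $\mathcal C_2\subseteq\mathbb F^m$ be a nonzero skew-cyclic code (with respect to $\theta$) with minimum rank distance $\mathrm d_{\mathrm{rk}}$ over $\mathbb F/\mathbb E$. Let $r\ge0$ and let $b,s,\delta,k_0,\dots,k_r$ be integers such that $\gcd(\ell m,s)=1$, $k_i<k_{i+1}$ for $i=0,\dots,r-1$, and $k_r-k_0\le\delta+r-2$. Let $a\in\mathbb K$ be a primitive $\ell$-th root of unity and let $\beta$ be a normal element of $\mathbb L/\mathbb K$. If $$\{(a^{b+si+k_j},\sigma^{si+k_j}(\beta))\in\mathbb K\times\mathbb L^*:\ 0\le i\le\delta-2,\ 0\le j\le r\}\subseteq T^{\mathrm H}_{\mathcal C_1}\uplus T^{\mathrm{rk}}_{\mathcal C_2},$$ then $$\mathrm d_{\mathrm H}\ge\left\lceil\frac{\delta+r}{\mathrm d_{\mathrm{rk}}}\right\rceil\qquad\text{and}\qquad \mathrm d_{\mathrm{rk}}\ge\left\lceil\frac{\delta+r}{\mathrm d_{\mathrm H}}\right\rceil.$$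
   Context: Setting. $\mathbb K/\mathbb E$ and $\mathbb F/\mathbb E$ are field extensions (inside a common field) of finite degrees $h$ and $m$, with $\mathbb K\cap\mathbb F=\mathbb E$; $\mathbb L=\mathbb F\mathbb K$, with $[\mathbb L:\mathbb F]=h$ and $[\mathbb L:\mathbb K]=m$. $\mathbb L/\mathbb K$ is a cyclic Galois extension, $\sigma\in\mathrm{Gal}(\mathbb L/\mathbb K)$, and $\theta=\sigma|_{\mathbb F}$ is an automorphism of $\mathbb F$ of order $m$ with fixed field $\mathbb E$ (so $\sigma$ generates $\mathrm{Gal}(\mathbb L/\mathbb K)$). $\ell$ is a positive integer such that $x^\ell-1$ has $\ell$ pairwise distinct roots, all in $\mathbb K$; moreover $\ell$ is coprime to $\mathrm{char}(\mathbb K)$ and to $m$. An element $\beta\in\mathbb L$ is normal if $\beta,\sigma(\beta),\dots,\sigma^{m-1}(\beta)$ is a $\mathbb K$-basis of $\mathbb L$. Codes. Codes are $\mathbb F$-linear subspaces. The minimum Hamming (resp. rank) distance is the minimum over nonzero codewords of the Hamming weight (resp. of the rank weight $\mathrm{wt}_{\mathrm{rk}}(v)=\dim_{\mathbb E}\langle v_0,\dots,v_{m-1}\rangle_{\mathbb E}$). $\mathcal C_1\subseteq\mathbb F^\ell$ is cyclic if it is invariant under the cyclic shift; equivalently $\mu_{\mathrm H}(\mathcal C_1)$ is an ideal of $\mathbb F[x]/(x^\ell-1)$, where $\mu_{\mathrm H}(u_0,\dots,u_{\ell-1})=\sum_i u_ix^i$; a generator polynomial $f_1$ satisfies $\mu_{\mathrm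 H}(\mathcal C_1)=(f_1(x))$. $\mathcal C_2\subseteq\mathbb F^m$ is skew-cyclic if it is invariant under $(v_0,\dots,v_{m-1})\mapsto(\theta(v_{m-1}),\theta(v_0),\dots,\theta(v_{m-2}))$; equivalently $\nu_{\mathrm{rk}}(\mathcal C_2)$ is a left ideal of $\mathbb F[z;\theta]/(z^m-1)$ (skew polynomials with $z\alpha=\theta(\alpha)z$), where $\nu_{\mathrm{rk}}(v_0,\dots,v_{m-1})=\sum_jv_jz^j$; it is generated by some $f_2(z)$. Defining sets. $T^{\mathrm H}_{\mathcal C_1}=\{a: a^\ell=1,\ f_1(a)=0\}$, a subset of the set $X=\{a\in\mathbb K:a^\ell=1\}$. For $f(z)=\sum_jf_jz^j$ and $\beta\in\mathbb L^*$ let $\mathrm{Ev}^\sigma_\beta(f)=\sum_jf_j\sigma^j(\beta)\beta^{-1}$ (the remainder of right division of $f$ by $z-\sigma(\beta)\beta^{-1}$ in $\mathbb L[z;\sigma]$); $T^{\mathrm{rk}}_{\mathcal C_2}=\{\beta\in\mathbb L^*:\mathrm{Ev}^\sigma_\beta(f_2)=0\}$, a subset of $Y=\mathbb L^*$. For $A\subseteq X$, $B\subseteq Y$: $A\uplus B=(A\times Y)\cup(X\times B)=\{(x,y)\in X\times Y: x\in A\text{ or }y\in B\}$. *)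

theory Defs
  imports
    "HOL-Algebra.Algebra"
    "HOL-Algebra.Algebraic_Closure_Type"
    "Jordan_Normal_Form.Matrix"
begin

section \<open>Subfields of an ambient field\<close>

text \<open>
  The common field containing all the fields under consideration is the type \<open>'a\<close>; the fields
  themselves are subsets of it. Subfields, degrees and spans are those of HOL-Algebra, applied to
  \<open>'a\<close> viewed as a ring record.
\<close>

abbreviation ambient :: "'a::field ring" where
  "ambient \<equiv> ring_of_type_algebra"

abbreviation is_subfield :: "'a::field set \<Rightarrow> bool" where
  "is_subfield K \<equiv> subfield K ambient"

text \<open>\<open>has_degree L K n\<close> means $[L:K] = n$ and in particular that the degree is finite.\<close>

abbreviation has_degree :: "'a::field set \<Rightarrow> 'a set \<Rightarrow> nat \<Rightarrow> bool" where
  "has_degree L K n \<equiv> K \<subseteq> L \<and> ring.dimension ambient n K L"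

abbreviation compositum :: "'a::field set \<Rightarrow> 'a set \<Rightarrow> 'a set" where
  "compositum F K \<equiv> generate_field ambient (F \<union> K)"

definition is_basis :: "'a::field set \<Rightarrow> 'a list \<Rightarrow> 'a set \<Rightarrow> bool" where
  "is_basis K us L \<longleftrightarrow>
     ring.independent ambient K us \<and> ring.Span ambient K us = L"

text \<open>
  Automorphisms of \<open>L\<close> are functions on \<open>'a\<close> that are \<open>undefined\<close> outside \<open>L\<close>, as in
  \<open>BijGroup\<close>, so that they form a group under composition.
\<close>

definition Gal :: "'a::field set \<Rightarrow> 'a set \<Rightarrow> ('a \<Rightarrow> 'a) monoid" where
  "Gal L K = BijGroup L \<lparr>carrier :=
     {\<tau> \<in> Bij L. \<tau> \<in> ring_iso (ambient\<lparr>carrier := L\<rparr>) (ambient\<lparr>carrier := L\<rparr>) \<and>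
                 (\<forall>x\<in>K. \<tau> x = x)}\<rparr>"

definition finite_galois :: "'a::field set \<Rightarrow> 'a set \<Rightarrow> bool" where
  "finite_galois L K \<longleftrightarrow>
     is_subfield L \<and> is_subfield K \<and> K \<subseteq> L \<and> ring.finite_dimension ambient K L \<and>
     {x\<in>L. \<forall>\<tau>\<in>carrier (Gal L K). \<tau> x = x} = K"

definition cyclic_galois :: "'a::field set \<Rightarrow> 'a set \<Rightarrow> bool" where
  "cyclic_galois L K \<longleftrightarrow> finite_galois L K \<and> cyclic_group (Gal L K)"

definition normal_element ::
    "'a::field set \<Rightarrow> 'a set \<Rightarrow> ('a \<Rightarrow> 'a) \<Rightarrow> nat \<Rightarrow> 'a \<Rightarrow> bool" where
  "normal_element L K \<sigma> m \<beta> \<longleftrightarrow>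
     \<beta> \<in> L \<and> is_basis K (map (\<lambda>j. (\<sigma> ^^ j) \<beta>) [0..<m]) L"

definition primitive_root_of_unity :: "nat \<Rightarrow> 'a::field \<Rightarrow> bool" where
  "primitive_root_of_unity l a \<longleftrightarrow>
     l > 0 \<and> a ^ l = 1 \<and> (\<forall>n. 0 < n \<and> n < l \<longrightarrow> a ^ n \<noteq> 1)"


section \<open>Codes\<close>

definition words :: "'a set \<Rightarrow> nat \<Rightarrow> 'a vec set" where
  "words F n = {v \<in> carrier_vec n. \<forall>i<n. v $ i \<in> F}"

definition linear_code :: "'a::field set \<Rightarrow> nat \<Rightarrow> 'a vec set \<Rightarrow> bool" where
  "linear_code F n C \<longleftrightarrow>
     C \<subseteq> words F n \<and> 0\<^sub>v n \<in> C \<and> (\<forall>u\<in>C. \<forall>v\<in>C. u + v \<in> C) \<and>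
     (\<forall>c\<in>F. \<forall>v\<in>C. c \<cdot>\<^sub>v v \<in> C)"

text \<open>$(v_0,\dots,v_{n-1}) \mapsto (\theta(v_{n-1}),\theta(v_0),\dots,\theta(v_{n-2}))$\<close>

definition skew_shift :: "('a \<Rightarrow> 'a) \<Rightarrow> 'a vec \<Rightarrow> 'a vec" where
  "skew_shift \<theta> v =
     vec (dim_vec v) (\<lambda>i. \<theta> (v $ (if i = 0 then dim_vec v - 1 else i - 1)))"

definition cyclic_code :: "'a::field set \<Rightarrow> nat \<Rightarrow> 'a vec set \<Rightarrow> bool" where
  "cyclic_code F n C \<longleftrightarrow> linear_code F n C \<and> skew_shift (\<lambda>x. x) ` C \<subseteq> C"

definition skew_cyclic_code ::
    "'a::field set \<Rightarrow> ('a \<Rightarrow> 'a) \<Rightarrow> nat \<Rightarrow> 'a vec set \<Rightarrow> bool" where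
  "skew_cyclic_code F \<theta> n C \<longleftrightarrow> linear_code F n C \<and> skew_shift \<theta> ` C \<subseteq> C"

definition hamming_weight :: "'a::field vec \<Rightarrow> nat" where
  "hamming_weight v = card {i. i < dim_vec v \<and> v $ i \<noteq> 0}"

definition rank_weight :: "'a::field set \<Rightarrow> 'a vec \<Rightarrow> nat" where
  "rank_weight E v = ring.dim ambient E (ring.Span ambient E (list_of_vec v))"

text \<open>The minimum is attained for every code containing a nonzero word.\<close>

definition min_distance :: "('a::field vec \<Rightarrow> nat) \<Rightarrow> 'a vec set \<Rightarrow> nat" where
  "min_distance wt C = Inf {wt v |v. v \<in> C \<and> v \<noteq> 0\<^sub>v (dim_vec v)}"


section \<open>Polynomials, skew polynomials and generators\<close>

definition polys_over :: "'a::field set \<Rightarrow> 'a poly set" where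
  "polys_over F = {p. \<forall>i. Polynomial.coeff p i \<in> F}"

text \<open>Underlies both $\mu_H$ (into $F[x]$) and $\nu_{rk}$ (into $F[z;\theta]$).\<close>

definition poly_of_word :: "'a::field vec \<Rightarrow> 'a poly" where
  "poly_of_word v = (\<Sum>i<dim_vec v. Polynomial.monom (v $ i) i)"

text \<open>
  Skew polynomials $\sum_i f_i z^i$, coefficients on the left, are represented by the same type as
  ordinary polynomials; \<open>skew_mult \<theta>\<close> is the product determined by $z \alpha = \theta(\alpha) z$.
\<close>

definition skew_mult :: "('a::field \<Rightarrow> 'a) \<Rightarrow> 'a poly \<Rightarrow> 'a poly \<Rightarrow> 'a poly" where
  "skew_mult \<theta> f g =
     (\<Sum>i\<le>Polynomial.degree f. \<Sum>j\<le>Polynomial.degree g.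
        Polynomial.monom
          (Polynomial.coeff f i * (\<theta> ^^ i) (Polynomial.coeff g j)) (i + j))"

abbreviation pow_minus_one :: "nat \<Rightarrow> 'a::field poly" where
  "pow_minus_one n \<equiv> Polynomial.monom 1 n - 1"

text \<open>
  Equality of subsets of the quotient ring $F[x]/(x^\ell-1)$ is expressed by equality of their
  preimages in $F[x]$: below, the preimage of $\mu_H(C)$ is on the left and that of the ideal
  generated by the class of \<open>f\<close> is on the right.
\<close>

definition generator_poly ::
    "'a::field set \<Rightarrow> nat \<Rightarrow> 'a vec set \<Rightarrow> 'a poly \<Rightarrow> bool" where
  "generator_poly F l C f \<longleftrightarrow>
     f \<in> polys_over F \<and>
     {poly_of_word u + h * pow_minus_one l |u h. u \<in> C \<and> h \<in> polys_over F} =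
     {g * f + h * pow_minus_one l |g h. g \<in> polys_over F \<and> h \<in> polys_over F}"

text \<open>
  Likewise for left ideals of $F[z;\theta]/(z^m-1)$. Here $\theta^m = 1$, so $z^m-1$ is central and
  its left multiples form a two-sided ideal.
\<close>

definition skew_generator_poly ::
    "'a::field set \<Rightarrow> ('a \<Rightarrow> 'a) \<Rightarrow> nat \<Rightarrow> 'a vec set \<Rightarrow> 'a poly \<Rightarrow> bool" where
  "skew_generator_poly F \<theta> m C f \<longleftrightarrow>
     f \<in> polys_over F \<and>
     {poly_of_word v + skew_mult \<theta> h (pow_minus_one m) |v h. v \<in> C \<and> h \<in> polys_over F} =
     {skew_mult \<theta> g f + skew_mult \<theta> h (pow_minus_one m)
        |g h. g \<in> polys_over F \<and> h \<in> polys_over F}"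


section \<open>Defining sets\<close>

definition roots_of_unity_in :: "'a::field set \<Rightarrow> nat \<Rightarrow> 'a set" where
  "roots_of_unity_in K l = {a \<in> K. a ^ l = 1}"

definition T_H :: "'a::field set \<Rightarrow> nat \<Rightarrow> 'a poly \<Rightarrow> 'a set" where
  "T_H K l f = {a \<in> roots_of_unity_in K l. poly f a = 0}"

definition Ev :: "('a::field \<Rightarrow> 'a) \<Rightarrow> 'a \<Rightarrow> 'a poly \<Rightarrow> 'a" where
  "Ev \<sigma> \<beta> f =
     (\<Sum>j\<le>Polynomial.degree f. Polynomial.coeff f j * (\<sigma> ^^ j) \<beta> * inverse \<beta>)"

definition T_rk :: "'a::field set \<Rightarrow> ('a \<Rightarrow> 'a) \<Rightarrow> 'a poly \<Rightarrow> 'a set" where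
  "T_rk L \<sigma> f = {\<beta> \<in> L - {0}. Ev \<sigma> \<beta> f = 0}"

definition defset_union :: "'a set \<Rightarrow> 'b set \<Rightarrow> 'a set \<Rightarrow> 'b set \<Rightarrow> ('a \<times> 'b) set" where
  "defset_union S T A B = (A \<times> T) \<union> (S \<times> B)"

end

theory Submission
  imports Defs
begin

text \<open>
  Let \<open>u\<close> and \<open>v\<close> be codewords of minimum weight, let \<open>c 0, \<dots>, c (d_rk - 1)\<close> be an \<open>E\<close>-basis of the span of
  the entries of \<open>v\<close>, and write \<open>v_j = (\<Sum>p. e p j * c p)\<close>. Multiplying the value of \<open>u\<close> at \<open>a^(b + t)\<close> by that of
  \<open>v\<close> at \<open>\<sigma>^t \<beta>\<close> gives a sum of \<open>d_H * d_rk\<close> terms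
  \<open>(u_i * a^(b i) * c p) * (a^i)^t * \<sigma>^t (g p)\<close>, with \<open>g p = (\<Sum>j. e p j * \<sigma>^j \<beta>)\<close>, which vanishes for all
  exponents \<open>t\<close> of the pattern. Both families \<open>c\<close> and \<open>g\<close> are linearly independent over \<open>K\<close>, and the
  \<open>m\<close>-th powers of the \<open>a^i\<close> are distinct because \<open>gcd(l, m) = 1\<close>, so a common generalization of the Moore and
  Vandermonde determinants applies to each of them. Roos' argument for cyclic codes then shows that a
  nontrivial relation of this kind has at least \<open>\<delta> + r\<close> terms.
\<close>

section \<open>Linear algebra over subfields\<close>

lemma ambient_simps [simp]:
  "carrier (ambient :: 'a::field ring) = UNIV"
  "x \<otimes>\<^bsub>ambient\<^esub> y = x * y"
  "x \<oplus>\<^bsub>ambient\<^esub> y = x + y"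
  "\<one>\<^bsub>ambient\<^esub> = (1::'a)"
  "\<zero>\<^bsub>ambient\<^esub> = (0::'a)"
  by (simp_all add: ring_of_type_algebra_def)

lemma ring_ambient: "ring (ambient :: 'a::field ring)"
  by (rule ring_from_type_algebra)

lemma ambient_inverse:
  assumes "x \<noteq> (0::'a::field)"
  shows "inv\<^bsub>ambient\<^esub> x = inverse x"
proof -
  interpret cring "ambient :: 'a ring" by (rule cring_from_type_algebra)
  show ?thesis using comm_inv_char[of x "inverse x"] assms by simp
qed

lemma ambient_uminus: "\<ominus>\<^bsub>ambient\<^esub> x = - (x::'a::field)"
proof -
  interpret cring "ambient :: 'a ring" by (rule cring_from_type_algebra)
  show ?thesis using minus_equality[of "- x" x] by simp
qed

context
  fixes K :: "'a::field set"
  assumes K: "is_subfield K"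
begin

lemma subfield_0: "0 \<in> K"
  and subfield_1: "1 \<in> K"
  and subfield_add: "x \<in> K \<Longrightarrow> y \<in> K \<Longrightarrow> x + y \<in> K"
  and subfield_mult: "x \<in> K \<Longrightarrow> y \<in> K \<Longrightarrow> x * y \<in> K"
  and subfield_uminus: "x \<in> K \<Longrightarrow> - x \<in> K"
  using subringE[OF subfieldE(1)[OF K]] by (simp_all add: ambient_uminus)

lemma subfield_inverse: "x \<in> K \<Longrightarrow> inverse x \<in> K"
  using ring.subfield_m_inv(1)[OF ring_ambient K, of x]
  by (cases "x = 0") (simp_all add: ambient_inverse subfield_0)

lemma subfield_diff: "x \<in> K \<Longrightarrow> y \<in> K \<Longrightarrow> x - y \<in> K"
  using subfield_add[OF _ subfield_uminus, of x y] by simp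

lemma subfield_divide: "x \<in> K \<Longrightarrow> y \<in> K \<Longrightarrow> x / y \<in> K"
  by (simp add: divide_inverse subfield_mult subfield_inverse)

lemma subfield_power: "x \<in> K \<Longrightarrow> x ^ n \<in> K"
  by (induction n) (simp_all add: subfield_1 subfield_mult)

lemma subfield_power_int: "x \<in> K \<Longrightarrow> x powi n \<in> K"
  by (simp add: power_int_def subfield_power subfield_inverse)

lemma subfield_sum: "(\<And>x. x \<in> A \<Longrightarrow> f x \<in> K) \<Longrightarrow> sum f A \<in> K"
  by (induction A rule: infinite_finite_induct) (simp_all add: subfield_0 subfield_add)

lemmas subfield_intros = subfield_0 subfield_1 subfield_add subfield_mult subfield_uminus
  subfield_inverse subfield_diff subfield_divide subfield_power subfield_power_int subfield_sum

text \<open>Gaussian elimination by induction on the set \<open>B\<close> of equations: one equation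
  is solved for a pivot unknown \<open>x0\<close>, and the solution is substituted into the
  others.\<close>

lemma underdetermined_system:
  assumes "finite B" "finite A" "card B < card A"
    and "\<And>i x. i \<in> B \<Longrightarrow> x \<in> A \<Longrightarrow> M i x \<in> K"
  obtains d where "\<And>x. x \<in> A \<Longrightarrow> d x \<in> K" "\<exists>x\<in>A. d x \<noteq> 0"
    "\<And>i. i \<in> B \<Longrightarrow> (\<Sum>x\<in>A. M i x * d x) = 0"
proof -
  have "\<exists>d. (\<forall>x\<in>A. d x \<in> K) \<and> (\<exists>x\<in>A. d x \<noteq> 0) \<and> (\<forall>i\<in>B. (\<Sum>x\<in>A. M i x * d x) = 0)"
    using assms
  proof (induction B arbitrary: A M)
    case empty
    then show ?case by (intro exI[of _ "\<lambda>_. 1"]) (auto simp: subfield_1 card_gt_0_iff)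
  next
    case (insert b B)
    show ?case
    proof (cases "\<exists>x0\<in>A. M b x0 \<noteq> 0")
      case False
      have "\<exists>d. (\<forall>x\<in>A. d x \<in> K) \<and> (\<exists>x\<in>A. d x \<noteq> 0) \<and> (\<forall>i\<in>B. (\<Sum>x\<in>A. M i x * d x) = 0)"
        using insert.prems insert.hyps by (intro insert.IH) auto
      then obtain d where "\<forall>x\<in>A. d x \<in> K" "\<exists>x\<in>A. d x \<noteq> 0" "\<forall>i\<in>B. (\<Sum>x\<in>A. M i x * d x) = 0"
        by blast
      moreover have "(\<Sum>x\<in>A. M b x * d x) = 0" using False by (simp add: sum.neutral)
      ultimately show ?thesis by blast
    next
      case True
      then obtain x0 where x0: "x0 \<in> A" "M b x0 \<noteq> 0" by blast
      define M' where "M' = (\<lambda>i x. M i x - M i x0 * (M b x / M b x0))"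
      have "\<exists>d. (\<forall>x\<in>A-{x0}. d x \<in> K) \<and> (\<exists>x\<in>A-{x0}. d x \<noteq> 0) \<and>
          (\<forall>i\<in>B. (\<Sum>x\<in>A-{x0}. M' i x * d x) = 0)"
        using insert.prems insert.hyps x0
        by (intro insert.IH) (auto simp: M'_def intro!: subfield_diff subfield_mult subfield_divide)
      then obtain d where d: "\<forall>x\<in>A-{x0}. d x \<in> K" "\<exists>x\<in>A-{x0}. d x \<noteq> 0"
          "\<forall>i\<in>B. (\<Sum>x\<in>A-{x0}. M' i x * d x) = 0"
        by blast
      define y where "y = - (\<Sum>x\<in>A-{x0}. M b x * d x) / M b x0"
      define d' where "d' = d(x0 := y)"
      have "y \<in> K"
        unfolding y_def using insert.prems d x0
        by (intro subfield_divide subfield_uminus subfield_sum subfield_mult) auto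
      have split: "(\<Sum>x\<in>A. M i x * d' x) = M i x0 * y + (\<Sum>x\<in>A-{x0}. M i x * d x)" for i
        using insert.prems(1) x0 by (subst sum.remove[of A x0]) (auto simp: d'_def intro: sum.cong)
      have "(\<Sum>x\<in>A. M i x * d' x) = 0" if "i \<in> insert b B" for i
      proof (cases "i = b")
        case True
        then show ?thesis unfolding split using x0 by (simp add: y_def)
      next
        case False
        then have "(\<Sum>x\<in>A-{x0}. M' i x * d x) = 0" using d that by simp
        moreover have "(\<Sum>x\<in>A-{x0}. M' i x * d x)
            = (\<Sum>x\<in>A-{x0}. M i x * d x) - M i x0 / M b x0 * (\<Sum>x\<in>A-{x0}. M b x * d x)"
          by (simp add: M'_def sum_subtractf[symmetric] sum_distrib_left algebra_simps)
        ultimately show ?thesis unfolding split by (simp add: y_def)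
      qed
      moreover have "\<forall>x\<in>A. d' x \<in> K" using d \<open>y \<in> K\<close> by (auto simp: d'_def)
      moreover have "\<exists>x\<in>A. d' x \<noteq> 0" using d by (auto simp: d'_def)
      ultimately show ?thesis by blast
    qed
  qed
  then show ?thesis using that by blast
qed

end

text \<open>Indexed families replace lists because independence is needed on the fibres of a map and
  on product index sets.\<close>

definition lin_indep_on :: "'a::field set \<Rightarrow> 'x set \<Rightarrow> ('x \<Rightarrow> 'a) \<Rightarrow> bool" where
  "lin_indep_on K A g \<longleftrightarrow>
     (\<forall>d. (\<forall>x\<in>A. d x \<in> K) \<longrightarrow> (\<Sum>x\<in>A. d x * g x) = 0 \<longrightarrow> (\<forall>x\<in>A. d x = 0))"

lemma lin_indep_onD:
  assumes "lin_indep_on K A g" "\<And>x. x \<in> A \<Longrightarrow> d x \<in> K" "(\<Sum>x\<in>A. d x * g x) = 0" "x \<in> A"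
  shows "d x = 0"
  using assms unfolding lin_indep_on_def by blast

section \<open>Moore--Vandermonde systems and the Roos argument\<close>

text \<open>\<open>S t\<close> models the \<open>t\<close>-th power of one automorphism. Exponents
  are integers because those of the Roos pattern may be negative. Both L/K and F/E provide
  instances.\<close>

locale cyclic_action =
  fixes L K :: "'a::field set" and S :: "int \<Rightarrow> 'a \<Rightarrow> 'a" and m :: nat
  assumes L: "is_subfield L" and K: "is_subfield K" and K_L: "K \<subseteq> L"
    and S_closed: "x \<in> L \<Longrightarrow> S t x \<in> L"
    and S_plus: "x \<in> L \<Longrightarrow> y \<in> L \<Longrightarrow> S t (x + y) = S t x + S t y"
    and S_times: "x \<in> L \<Longrightarrow> y \<in> L \<Longrightarrow> S t (x * y) = S t x * S t y"
    and S_0: "x \<in> L \<Longrightarrow> S 0 x = x"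
    and S_S: "x \<in> L \<Longrightarrow> S t (S u x) = S (t + u) x"
    and S_fix: "x \<in> K \<Longrightarrow> S t x = x"
    and S_period: "x \<in> L \<Longrightarrow> S (int m) x = x"
    and fixed_field: "x \<in> L \<Longrightarrow> S 1 x = x \<Longrightarrow> x \<in> K"
begin

lemma S_zero: "S t 0 = 0"
  by (rule S_fix[OF subfield_0[OF K]])

lemma S_sum:
  assumes "\<And>x. x \<in> A \<Longrightarrow> f x \<in> L"
  shows "S t (sum f A) = (\<Sum>x\<in>A. S t (f x))"
  using assms
  by (induction A rule: infinite_finite_induct)
    (simp_all add: S_zero S_plus subfield_sum[OF L])

lemma S_times_K: "x \<in> K \<Longrightarrow> y \<in> L \<Longrightarrow> S t (x * y) = x * S t y"
  using S_times[of x y t] K_L by (auto simp: S_fix)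

lemma S_eq_0_iff: "x \<in> L \<Longrightarrow> S t x = 0 \<longleftrightarrow> x = 0"
  using S_S[of x "- t" t] by (auto simp: S_zero S_0)

lemma S_fixed_multiple:
  assumes "x \<in> L" "S e x = x"
  shows "S (e * n) x = x"
proof (induction n rule: int_induct[of _ 0])
  case base
  show ?case using assms by (simp add: S_0)
next
  case (step1 i)
  then show ?case using S_S[OF assms(1), of "e * i" e] assms(2) by (simp add: algebra_simps)
next
  case (step2 i)
  have "S (- e) x = x" using S_S[OF assms(1), of "- e" e] assms by (simp add: S_0)
  then show ?case using step2 S_S[OF assms(1), of "e * i" "- e"] by (simp add: algebra_simps)
qed

text \<open>By Bezout, \<open>S 1\<close> is composed of a power of \<open>S e\<close> and a power
  of the identity \<open>S (int m)\<close>. This lets the exponent \<open>- s\<close> replace 1 in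
  the Moore-Vandermonde argument.\<close>

lemma fixed_field_coprime:
  assumes e: "coprime e (int m)" and x: "x \<in> L" "S e x = x"
  shows "x \<in> K"
proof -
  obtain u v where "u * e + v * int m = 1"
    using e bezout_int[of e "int m"] by auto
  moreover have "S (e * u + int m * v) x = x"
    using S_S[OF x(1), of "e * u" "int m * v"] S_fixed_multiple[OF x]
      S_fixed_multiple[OF x(1) S_period[OF x(1)]] by simp
  ultimately have "S 1 x = x" by (simp add: mult.commute)
  with x show ?thesis by (intro fixed_field)
qed

text \<open>
  This interpolates between the Moore determinant (all \<open>\<eta> x\<close> equal) and the Vandermonde determinant
  (all \<open>\<eta> x\<close> distinct). It is Artin's argument: in a normalised relation \<open>c\<close>, subtracting \<open>\<eta> x1\<close> times
  the image of the relation under the automorphism shortens it.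
\<close>

lemma moore_vandermonde:
  assumes "finite A" and e: "coprime e (int m)"
    and "\<And>x. x \<in> A \<Longrightarrow> \<eta> x \<in> K - {0}"
    and "\<And>x y. x \<in> A \<Longrightarrow> y \<in> A \<Longrightarrow> \<eta> x ^ m = \<eta> y ^ m \<Longrightarrow> \<eta> x = \<eta> y"
    and "\<And>x. x \<in> A \<Longrightarrow> g x \<in> L"
    and "\<And>z. lin_indep_on K {x\<in>A. \<eta> x = z} g"
    and "\<And>x. x \<in> A \<Longrightarrow> c x \<in> L"
    and "\<And>n. n < card A \<Longrightarrow>
      (\<Sum>x\<in>A. c x * \<eta> x powi (q + int n) * S (e * (q + int n)) (g x)) = 0"
  shows "\<forall>x\<in>A. c x = 0"
  using assms(1,3-)
\<comment> \<open>\<open>q\<close> is generalised because the shortened relation holds on a window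
  of exponents that starts one later.\<close>
proof (induction "card A" arbitrary: A c q)
  case 0
  then show ?case by simp
next
  case (Suc N)
  note [simp] = Suc.prems(1)
  note \<eta> = Suc.prems(2) and \<eta>_m = Suc.prems(3) and g = Suc.prems(4) and indep = Suc.prems(5)
    and c = Suc.prems(6) and eqs = Suc.prems(7)
  show ?case
  proof (rule ccontr)
    assume "\<not> (\<forall>x\<in>A. c x = 0)"
    then obtain x1 where x1: "x1 \<in> A" "c x1 \<noteq> 0" by blast
    define c' where "c' = (\<lambda>x. c x / c x1)"
    define w where "w = (\<lambda>p x. \<eta> x powi p * S (e * p) (g x))"
    define d where "d = (\<lambda>x. c' x - \<eta> x1 * S e (c' x) / \<eta> x)"
    have c'[simp]: "c' x \<in> L" if "x \<in> A" for x
      using that x1 c by (auto simp: c'_def intro: subfield_divide[OF L])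
    have c'1: "c' x1 = 1" using x1 by (simp add: c'_def)
    have \<eta>L: "\<eta> x \<in> L" and \<eta>K: "\<eta> x \<in> K" and \<eta>0: "\<eta> x \<noteq> 0" if "x \<in> A" for x
      using \<eta>[OF that] K_L by auto
    have wL: "w p x \<in> L" if "x \<in> A" for p x
      using that by (auto simp: w_def intro!: subfield_mult[OF L] subfield_power_int[OF L] \<eta>L S_closed g)
    have Sw: "S e (w p x) = w (p + 1) x / \<eta> x" if "x \<in> A" for p x
    proof -
      have "S e (w p x) = \<eta> x powi p * S (e * (p + 1)) (g x)"
        using that
        by (simp add: w_def S_times_K subfield_power_int[OF K] \<eta>K S_closed g S_S distrib_left add.commute)
      then show ?thesis using that by (simp add: w_def power_int_add_1 \<eta>0)
    qed
    have rel: "(\<Sum>x\<in>A. c' x * w (q + int n) x) = 0" if "n < card A" for n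
    proof -
      have "(\<Sum>x\<in>A. c' x * w (q + int n) x)
          = (\<Sum>x\<in>A. c x * \<eta> x powi (q + int n) * S (e * (q + int n)) (g x)) / c x1"
        by (simp add: c'_def w_def sum_divide_distrib mult.assoc)
      then show ?thesis using eqs[OF that] by simp
    qed
    have rel': "(\<Sum>x\<in>A. d x * w (q + 1 + int n) x) = 0" if "n < N" for n
    proof -
      have "0 = S e (\<Sum>x\<in>A. c' x * w (q + int n) x)"
        using rel[of n] that Suc.hyps(2) by (simp add: S_zero)
      also have "\<dots> = (\<Sum>x\<in>A. S e (c' x) * w (q + int n + 1) x / \<eta> x)"
        by (subst S_sum) (auto intro!: subfield_mult[OF L] wL sum.cong simp: S_times Sw wL)
      finally have "\<eta> x1 * (\<Sum>x\<in>A. S e (c' x) * w (q + int n + 1) x / \<eta> x) = 0" by simp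
      moreover have "(\<Sum>x\<in>A. c' x * w (q + int (Suc n)) x) = 0"
        using that Suc.hyps(2) by (intro rel) simp
      moreover have "(\<Sum>x\<in>A. d x * w (q + 1 + int n) x) =
          (\<Sum>x\<in>A. c' x * w (q + int (Suc n)) x)
          - \<eta> x1 * (\<Sum>x\<in>A. S e (c' x) * w (q + int n + 1) x / \<eta> x)"
        by (simp add: d_def sum_distrib_left sum_subtractf[symmetric] left_diff_distrib mult.assoc add_ac)
      ultimately show ?thesis by simp
    qed
    \<comment> \<open>The normalised coefficient \<open>c' x1 = 1\<close> is fixed by
      \<open>S e\<close>, so the term of \<open>x1\<close> cancels and the induction hypothesis
      applies to \<open>A - {x1}\<close>.\<close>
    have d1: "d x1 = 0"
      using \<eta>0[OF x1(1)] S_fix[OF subfield_1[OF K]] by (simp add: d_def c'1)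
    have "\<forall>x\<in>A-{x1}. d x = 0"
    proof (rule Suc.hyps(1)[where q = "q + 1"])
      show "N = card (A - {x1})" using x1 Suc.hyps(2) by simp
      show "lin_indep_on K {x \<in> A - {x1}. \<eta> x = z} g" for z
        unfolding lin_indep_on_def
      proof (intro allI impI ballI)
        fix f x
        assume f: "\<forall>x\<in>{x \<in> A - {x1}. \<eta> x = z}. f x \<in> K"
          "(\<Sum>x\<in>{x \<in> A - {x1}. \<eta> x = z}. f x * g x) = 0" and x: "x \<in> {x \<in> A - {x1}. \<eta> x = z}"
        define f' where "f' = f(x1 := 0)"
        have "(\<Sum>x\<in>{x\<in>A. \<eta> x = z}. f' x * g x) = (\<Sum>x\<in>{x \<in> A - {x1}. \<eta> x = z}. f x * g x)"
          by (rule sum.mono_neutral_cong_right) (auto simp: f'_def)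
        with f(2) have "(\<Sum>x\<in>{x\<in>A. \<eta> x = z}. f' x * g x) = 0" by simp
        moreover have "f' y \<in> K" if "y \<in> {x\<in>A. \<eta> x = z}" for y
          using f(1) that by (auto simp: f'_def subfield_0[OF K])
        moreover have "x \<in> {x\<in>A. \<eta> x = z}" using x by blast
        ultimately have "f' x = 0" using lin_indep_onD[OF indep[of z], of f' x] by blast
        then show "f x = 0" using x by (auto simp: f'_def)
      qed
      show "(\<Sum>x\<in>A - {x1}. d x * \<eta> x powi (q + 1 + int n) * S (e * (q + 1 + int n)) (g x)) = 0"
        if "n < card (A - {x1})" for n
      proof -
        have "(\<Sum>x\<in>A. d x * w (q + 1 + int n) x) = 0"
          using that x1 Suc.hyps(2) by (intro rel') simp
        moreover have "(\<Sum>x\<in>A. d x * w (q + 1 + int n) x) = (\<Sum>x\<in>A - {x1}. d x * w (q + 1 + int n) x)"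
          by (rule sum.mono_neutral_right) (use d1 in auto)
        ultimately show ?thesis by (simp add: w_def mult.assoc)
      qed
      show "\<eta> x = \<eta> y" if "x \<in> A - {x1}" "y \<in> A - {x1}" "\<eta> x ^ m = \<eta> y ^ m" for x y
        using that \<eta>_m[of x y] by blast
      show "d x \<in> L" if "x \<in> A - {x1}" for x
        using that x1
        by (auto simp: d_def intro!: subfield_diff[OF L] subfield_divide[OF L] subfield_mult[OF L] S_closed \<eta>L)
    qed (use \<eta> g in auto)
    with d1 have "d x = 0" if "x \<in> A" for x using that by (cases "x = x1") auto
    note d_0 = this
    have twist: "c' x * \<eta> x = \<eta> x1 * S e (c' x)" if "x \<in> A" for x
      
    proof -
      have "c' x = \<eta> x1 * S e (c' x) / \<eta> x"
        using d_0[OF that] by (simp add: d_def)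
      then show ?thesis using \<eta>0[OF that] by (simp add: nonzero_eq_divide_eq)
    qed
    \<comment> \<open>Iterating \<open>twist\<close> \<open>m\<close> times applies the identity
      \<open>S (e * int m)\<close> to \<open>c' x\<close>, so \<open>\<eta> x\<close> and
      \<open>\<eta> x1\<close> have equal \<open>m\<close>-th powers and hence coincide. Then
      \<open>twist\<close> says that \<open>c' x\<close> is fixed by \<open>S e\<close>.\<close>
    have same_class: "\<eta> x = \<eta> x1 \<and> c' x \<in> K" if x: "x \<in> A" "c' x \<noteq> 0" for x
    proof -
      have "S (e * int n) (c' x) * \<eta> x1 ^ n = c' x * \<eta> x ^ n" for n
      proof (induction n)
        case 0
        show ?case using x by (simp add: S_0)
      next
        case (Suc n)
        have "S (e * int (Suc n)) (c' x) = S (e * int n) (S e (c' x))"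
          using x by (simp add: S_S algebra_simps)
        also have "S e (c' x) = \<eta> x / \<eta> x1 * c' x"
          using twist[OF x(1)] \<eta>0[OF x1(1)] by (simp add: field_simps)
        also have "S (e * int n) \<dots> = \<eta> x / \<eta> x1 * S (e * int n) (c' x)"
          using x x1 by (intro S_times_K subfield_divide[OF K] \<eta>K) auto
        finally show ?case using Suc.IH \<eta>0[OF x1(1)] by (simp add: mult_ac)
      qed
      from this[of m] have "c' x * \<eta> x1 ^ m = c' x * \<eta> x ^ m"
        using S_fixed_multiple[OF c'[OF x(1)] S_period[OF c'[OF x(1)]], of e] by (simp add: mult.commute)
      then have "\<eta> x = \<eta> x1" using x \<eta>_m[OF x(1) x1(1)] by simp
      moreover from this have "c' x \<in> K"
        using twist[OF x(1)] \<eta>0[OF x1(1)] x by (intro fixed_field_coprime[OF e]) auto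
      ultimately show ?thesis by blast
    qed
    \<comment> \<open>The support of \<open>c'\<close> lies in one class of \<open>\<eta>\<close>
      and its values lie in \<open>K\<close>. So the relation for exponent \<open>q\<close> is the
      image under \<open>S (e * q)\<close> of a \<open>K\<close>-linear relation of \<open>g\<close>
      on this class.\<close>
    define Z where "Z = {x\<in>A. \<eta> x = \<eta> x1}"
    define f where "f = (\<lambda>x. c' x * \<eta> x1 powi q)"
    have "f x \<in> K" if "x \<in> Z" for x
      using that same_class[of x] x1
      by (cases "c' x = 0")
        (auto simp: f_def Z_def subfield_0[OF K] intro!: subfield_mult[OF K] subfield_power_int[OF K] \<eta>K)
    note fK = this
    have "S (e * q) (\<Sum>x\<in>Z. f x * g x) = (\<Sum>x\<in>Z. f x * S (e * q) (g x))"
      by (subst S_sum) (use fK K_L in \<open>auto simp: Z_def S_times_K g intro!: sum.cong subfield_mult[OF L]\<close>)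
    also have "\<dots> = (\<Sum>x\<in>Z. c' x * w q x)"
      by (intro sum.cong) (auto simp: f_def w_def Z_def)
    also have "\<dots> = (\<Sum>x\<in>A. c' x * w q x)"
      using same_class by (intro sum.mono_neutral_left) (auto simp: Z_def)
    also have "\<dots> = 0" using rel[of 0] Suc.hyps(2) by simp
    finally have "(\<Sum>x\<in>Z. f x * g x) = 0"
      using fK K_L by (subst (asm) S_eq_0_iff) (auto simp: Z_def intro!: subfield_sum[OF L] subfield_mult[OF L] g)
    then have "f x1 = 0"
      using lin_indep_onD[OF indep[of "\<eta> x1"], of f x1] fK x1 unfolding Z_def by blast
    then show False using c'1 \<eta>0[OF x1(1)] by (simp add: f_def)
  qed
qed

end

lemma sum_unit_vector:
  assumes "finite A" "x \<in> A"
  shows "(\<Sum>y\<in>A. (if y = x then 1 else 0) * g y) = (g x :: 'a::semiring_1)"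
proof -
  have "(\<Sum>y\<in>A. (if y = x then 1 else 0) * g y) = (\<Sum>y\<in>{x}. g y)"
    using assms by (intro sum.mono_neutral_cong_right) auto
  then show ?thesis by simp
qed

lemma lin_indep_on_nonzero:
  assumes "is_subfield K" "lin_indep_on K A g" "finite A" "x \<in> A"
  shows "g x \<noteq> 0"
proof
  assume "g x = 0"
  then have *: "(\<Sum>y\<in>A. (if y = x then 1 else 0) * g y) = 0"
    using assms(3,4) by (simp add: sum_unit_vector)
  have "(if x = x then 1 else 0 :: 'a) = 0"
    by (rule lin_indep_onD[where d = "\<lambda>y. if y = x then 1 else 0", OF assms(2) _ * assms(4)])
      (simp add: subfield_0[OF assms(1)] subfield_1[OF assms(1)])
  then show False by simp
qed

lemma lin_indep_on_empty: "lin_indep_on K {} g"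
  by (simp add: lin_indep_on_def)

context cyclic_action
begin

text \<open>
  After applying \<open>S (- s * i)\<close>, the hypothesis says that the vectors \<open>C i\<close> are orthogonal to the vectors
  \<open>G (k j)\<close>. If there were fewer than \<open>\<delta> + r\<close> terms, some nontrivial combination of the \<open>C i\<close> could be made
  orthogonal also to those \<open>G p\<close> with \<open>p\<close> in the gaps between the \<open>k j\<close>, hence to a full interval of them.
\<close>

lemma roos_bound:
  fixes \<zeta> g c :: "'x \<Rightarrow> 'a" and s \<delta> :: int and k :: "nat \<Rightarrow> int"
  assumes A: "finite A" "A \<noteq> {}" and s: "coprime s (int m)"
    and \<zeta>: "\<And>x. x \<in> A \<Longrightarrow> \<zeta> x \<in> K - {0}"
    and \<zeta>_m: "\<And>x y. x \<in> A \<Longrightarrow> y \<in> A \<Longrightarrow> \<zeta> x ^ m = \<zeta> y ^ m \<Longrightarrow> \<zeta> x = \<zeta> y"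
    and \<zeta>_s: "\<And>x y. x \<in> A \<Longrightarrow> y \<in> A \<Longrightarrow> (\<zeta> x powi s) ^ m = (\<zeta> y powi s) ^ m \<Longrightarrow> \<zeta> x = \<zeta> y"
    and g: "\<And>x. x \<in> A \<Longrightarrow> g x \<in> L" "\<And>z. lin_indep_on K {x\<in>A. \<zeta> x = z} g"
    and c: "\<And>x. x \<in> A \<Longrightarrow> c x \<in> L" "\<And>z. lin_indep_on K {x\<in>A. \<zeta> x = z} c"
    and k_mono: "\<And>i. i < r \<Longrightarrow> k i < k (i + 1)"
    and k_range: "k r - k 0 \<le> \<delta> + int r - 2"
    and rel: "\<And>i j. 0 \<le> i \<Longrightarrow> i \<le> \<delta> - 2 \<Longrightarrow> j \<le> r \<Longrightarrow>
      (\<Sum>x\<in>A. c x * \<zeta> x powi (s * i + k j) * S (s * i + k j) (g x)) = 0"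
  shows "\<delta> + int r \<le> int (card A)"
proof (rule ccontr)
  define n where "n = card A"
  assume "\<not> \<delta> + int r \<le> int (card A)"
  then have n: "int n < \<delta> + int r" by (simp add: n_def)
  have n_pos: "n > 0" using A by (simp add: n_def card_gt_0_iff)
  have k_diff: "k i + int (j - i) \<le> k j" if "i \<le> j" "j \<le> r" for i j
    using that
  proof (induction j rule: dec_induct)
    case (step j)
    then show ?case using k_mono[of j] by (simp add: Suc_diff_le)
  qed simp
  \<comment> \<open>Strictly increasing integers satisfy \<open>k r - k 0 \<ge> r\<close>;
    comparison with \<open>k_range\<close> shows that the pattern is nonempty.\<close>
  have \<delta>: "\<delta> \<ge> 2" using k_diff[of 0 r] k_range by simp
  have k_inj: "inj_on k {..r}"
  proof (rule linorder_inj_onI)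
    fix i j assume "i < j" "i \<in> {..r}" "j \<in> {..r}"
    then show "k i \<noteq> k j" using k_diff[of i j] by simp
  qed auto
  have k_bounds: "k 0 \<le> k j" "k j \<le> k r" if "j \<le> r" for j
    using that k_diff[of 0 j] k_diff[of j r] by auto
  have \<zeta>K: "\<zeta> x \<in> K" and \<zeta>L: "\<zeta> x \<in> L" and \<zeta>0: "\<zeta> x \<noteq> 0" if "x \<in> A" for x
    using \<zeta>[OF that] K_L by auto

  \<comment> \<open>The exponent \<open>s * i + k j\<close> is split. \<open>C i\<close> collects
    what depends on \<open>i\<close>: a power of \<open>\<zeta> x\<close>, which lies in
    \<open>K\<close> and is fixed by \<open>S\<close>, and the automorphism moved from
    \<open>g\<close> to \<open>c\<close>. \<open>G p\<close> keeps the part with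
    \<open>p = k j\<close>.\<close>
  define C where "C = (\<lambda>(i::nat) x. (\<zeta> x powi s) powi int i * S (- s * int i) (c x))"
  define G where "G = (\<lambda>p x. \<zeta> x powi p * S p (g x))"
  have CL: "C i x \<in> L" and GL: "G p x \<in> L" if "x \<in> A" for i p x
    using that unfolding C_def G_def
    by (auto intro!: subfield_mult[OF L] subfield_power[OF L] subfield_power_int[OF L] \<zeta>L S_closed g c)
  have orth: "(\<Sum>x\<in>A. C i x * G (k j) x) = 0" if "int i \<le> \<delta> - 2" "j \<le> r" for i j
  proof -
    have "0 = S (- s * int i)
        (\<Sum>x\<in>A. c x * \<zeta> x powi (s * int i + k j) * S (s * int i + k j) (g x))"
      using rel[of "int i" j] that by (simp add: S_zero)
    also have "\<dots> = (\<Sum>x\<in>A. S (- s * int i)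
        (c x * \<zeta> x powi (s * int i + k j) * S (s * int i + k j) (g x)))"
      by (rule S_sum) (auto intro!: subfield_mult[OF L] subfield_power_int[OF L] \<zeta>L S_closed g c)
    also have "\<dots> = (\<Sum>x\<in>A. C i x * G (k j) x)"
    proof (rule sum.cong[OF refl])
      fix x assume x: "x \<in> A"
      have "S (- s * int i) (c x * \<zeta> x powi (s * int i + k j) * S (s * int i + k j) (g x))
          = S (- s * int i) (\<zeta> x powi (s * int i + k j) * (c x * S (s * int i + k j) (g x)))"
        by (simp add: mult_ac)
      also have "\<dots> = \<zeta> x powi (s * int i + k j) *
          (S (- s * int i) (c x) * S (- s * int i + (s * int i + k j)) (g x))"
        using x
        by (simp add: S_times_K subfield_power_int[OF K] \<zeta>K subfield_mult[OF L] S_closed c g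
            S_times S_S)
      also have "\<dots> = C i x * G (k j) x"
        using \<zeta>0[OF x] by (simp add: C_def G_def power_int_add power_int_mult mult_ac)
      finally show "S (- s * int i) (c x * \<zeta> x powi (s * int i + k j) * S (s * int i + k j) (g x))
          = C i x * G (k j) x" .
    qed
    finally show ?thesis by simp
  qed

  \<comment> \<open>The first \<open>n\<close> rows \<open>C i\<close> form a Moore-Vandermonde
    system for \<open>S (- s)\<close> with multipliers \<open>\<zeta> x powi s\<close>. By
    \<open>\<zeta>_s\<close> these multipliers define the same classes as \<open>\<zeta>\<close>, so
    \<open>c\<close> stays independent on each class.\<close>
  have C_sep: "\<forall>x\<in>A. d x = 0"
    if d: "\<And>x. x \<in> A \<Longrightarrow> d x \<in> L" "\<And>i. i < n \<Longrightarrow> (\<Sum>x\<in>A. d x * C i x) = 0" for d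
  proof (rule moore_vandermonde[where e = "- s" and \<eta> = "\<lambda>x. \<zeta> x powi s" and g = c and q = 0])
    show "lin_indep_on K {x \<in> A. \<zeta> x powi s = z} c" for z
    proof (cases "\<exists>x1\<in>A. \<zeta> x1 powi s = z")
      case True
      then obtain x1 where x1: "x1 \<in> A" "\<zeta> x1 powi s = z" by blast
      have "\<zeta> x = \<zeta> x1 \<longleftrightarrow> \<zeta> x powi s = z" if "x \<in> A" for x
        using \<zeta>_s[OF that x1(1)] x1(2) by (metis (no_types))
      then have "{x \<in> A. \<zeta> x powi s = z} = {x \<in> A. \<zeta> x = \<zeta> x1}" by blast
      with c(2) show ?thesis by simp
    next
      case False
      then have "{x \<in> A. \<zeta> x powi s = z} = {}" by blast
      then show ?thesis by (simp only: lin_indep_on_empty)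
    qed
    show "\<zeta> x powi s = \<zeta> y powi s" if "x \<in> A" "y \<in> A" "(\<zeta> x powi s) ^ m = (\<zeta> y powi s) ^ m" for x y
      using \<zeta>_s[OF that] by simp
    show "(\<Sum>x\<in>A. d x * (\<zeta> x powi s) powi (0 + int i) * S (- s * (0 + int i)) (c x)) = 0"
      if "i < card A" for i
      using d(2)[of i] that by (simp add: C_def n_def mult.assoc)
    show "\<zeta> x powi s \<in> K - {0}" if "x \<in> A" for x
      using \<zeta>[OF that] by (simp add: subfield_power_int[OF K])
  qed (fact A(1) c(1) d(1) | use s in simp)+
  have G_sep: "\<forall>x\<in>A. d x = 0"
    if d: "\<And>x. x \<in> A \<Longrightarrow> d x \<in> L" "\<And>i. i < n \<Longrightarrow> (\<Sum>x\<in>A. d x * G (k 0 + int i) x) = 0" for d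
  proof (rule moore_vandermonde[where e = 1 and \<eta> = \<zeta> and g = g and q = "k 0"])
    show "(\<Sum>x\<in>A. d x * \<zeta> x powi (k 0 + int i) * S (1 * (k 0 + int i)) (g x)) = 0"
      if "i < card A" for i
      using d(2)[of i] that by (simp add: G_def n_def mult.assoc)
  qed (fact A(1) \<zeta> \<zeta>_m g d(1) | simp)+

  show False
  proof (cases "int n \<le> \<delta> - 2")
    \<comment> \<open>All row indices below \<open>n\<close> are at most
      \<open>\<delta> - 2\<close>, so \<open>G (k 0)\<close> is orthogonal to \<open>n\<close> rows
      and vanishes, which the independence of \<open>g\<close> forbids.\<close>
    case True
    have "\<forall>x\<in>A. G (k 0) x = 0"
      using orth[of _ 0] True by (intro C_sep GL) (auto simp: mult.commute)
    moreover obtain x where x: "x \<in> A" using A by blast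
    ultimately have "g x = 0" using \<zeta>0[OF x] g(1)[OF x] by (auto simp: G_def S_eq_0_iff)
    then show False using lin_indep_on_nonzero[OF K g(2)[of "\<zeta> x"], of x] x A by simp
  next
    case False
    \<comment> \<open>\<open>D\<close> counts the row indices from 0 to \<open>\<delta> - 2\<close>.
      \<open>N\<close> is the length of an interval from \<open>k 0\<close> that contains all
      \<open>k j\<close> and at least \<open>n\<close> exponents; \<open>B\<close> is the set of its
      gaps. As \<open>N \<le> \<delta> + r - 1\<close>, removing the \<open>r + 1\<close> values of
      \<open>k\<close> leaves at most \<open>\<delta> - 2\<close> gaps, fewer than
      \<open>D\<close>.\<close>
    define D where "D = nat (\<delta> - 1)"
    define N where "N = max (int n) (k r - k 0 + 1)"
    define B where "B = {k 0..<k 0 + N} - k ` {..r}"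
    have "k ` {..r} \<subseteq> {k 0..<k 0 + N}"
      using k_bounds by (force simp: N_def)
    then have "card B = nat N - (r + 1)"
      unfolding B_def using k_inj by (simp add: card_Diff_subset card_image)
    moreover have "N \<le> \<delta> + int r - 1" "N \<ge> int r + 1"
      using n k_range k_diff[of 0 r] by (auto simp: N_def)
    ultimately have card_B: "card B < card {..<D}" by (simp add: D_def)
    obtain \<alpha> where \<alpha>: "\<And>i. i \<in> {..<D} \<Longrightarrow> \<alpha> i \<in> L" "\<exists>i\<in>{..<D}. \<alpha> i \<noteq> 0"
        "\<And>p. p \<in> B \<Longrightarrow> (\<Sum>i<D. (\<Sum>x\<in>A. C i x * G p x) * \<alpha> i) = 0"
      using underdetermined_system[OF L _ _ card_B, of "\<lambda>p i. \<Sum>x\<in>A. C i x * G p x"]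
      by (auto simp: B_def intro!: subfield_sum[OF L] subfield_mult[OF L] CL GL)
    \<comment> \<open>This combination of rows is orthogonal to \<open>G p\<close> at the gaps by
      the choice of \<open>\<alpha>\<close> and at the \<open>k j\<close> by \<open>orth\<close>, so
      \<open>G_sep\<close> makes it zero.\<close>
    define d where "d = (\<lambda>x. \<Sum>i<D. \<alpha> i * C i x)"
    have dG: "(\<Sum>x\<in>A. d x * G p x) = (\<Sum>i<D. (\<Sum>x\<in>A. C i x * G p x) * \<alpha> i)" for p
      unfolding d_def sum_distrib_right
      by (subst sum.swap) (simp add: mult_ac)
    have "\<forall>x\<in>A. d x = 0"
    proof (rule G_sep)
      show "d x \<in> L" if "x \<in> A" for x
        using that \<alpha>(1) by (auto simp: d_def intro!: subfield_sum[OF L] subfield_mult[OF L] CL)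
      fix i assume i: "i < n"
      show "(\<Sum>x\<in>A. d x * G (k 0 + int i) x) = 0"
      proof (cases "k 0 + int i \<in> k ` {..r}")
        case True
        then obtain j where "j \<le> r" "k 0 + int i = k j" by auto
        then show ?thesis unfolding dG by (intro sum.neutral) (auto simp: orth D_def)
      next
        case False
        then have "k 0 + int i \<in> B" using i by (simp add: B_def N_def)
        then show ?thesis unfolding dG by (rule \<alpha>(3))
      qed
    qed
    note d_0 = this
    obtain i0 where i0: "i0 < D" "\<alpha> i0 \<noteq> 0" using \<alpha>(2) by auto
    have D_n: "D \<le> n" using False \<delta> by (simp add: D_def)
    \<comment> \<open>The vanishing of \<open>d\<close> is a dependence among the first
      \<open>n\<close> rows. It contradicts \<open>C_sep\<close>: a nonzero \<open>f\<close>
      orthogonal to the rows other than \<open>i0\<close> is also orthogonal to row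
      \<open>i0\<close>, a combination of them.\<close>
    have "card ({..<n} - {i0}) < card A" using i0 D_n n_pos by (simp add: n_def)
    then obtain f where f: "\<And>x. x \<in> A \<Longrightarrow> f x \<in> L" "\<exists>x\<in>A. f x \<noteq> 0"
        "\<And>i. i \<in> {..<n} - {i0} \<Longrightarrow> (\<Sum>x\<in>A. C i x * f x) = 0"
      using underdetermined_system[OF L _ A(1), of "{..<n} - {i0}" C] CL by auto
    have "\<alpha> i0 * (\<Sum>x\<in>A. C i0 x * f x) = (\<Sum>i<D. \<alpha> i * (\<Sum>x\<in>A. C i x * f x))"
      using i0 D_n f(3) by (subst sum.remove[of _ i0]) (auto intro!: sum.neutral)
    also have "\<dots> = (\<Sum>x\<in>A. d x * f x)"
      unfolding d_def sum_distrib_right sum_distrib_left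
      by (subst sum.swap) (simp add: mult_ac)
    also have "\<dots> = 0" using d_0 by simp
    finally have i0_orth: "(\<Sum>x\<in>A. C i0 x * f x) = 0" using i0 by simp
    have "\<forall>x\<in>A. f x = 0"
    proof (rule C_sep[OF f(1)])
      fix i assume "i < n"
      then have "(\<Sum>x\<in>A. C i x * f x) = 0" using i0_orth f(3)[of i] by (cases "i = i0") auto
      then show "(\<Sum>x\<in>A. f x * C i x) = 0" by (simp add: mult.commute)
    qed
    then show False using f(2) by blast
  qed
qed

end

section \<open>Bases and Galois groups\<close>

lemma combine_ambient:
  "ring.combine ambient Ks Us = (\<Sum>i<min (length Ks) (length Us). Ks ! i * (Us ! i :: 'a::field))"
proof -
  interpret ring "ambient :: 'a ring" by (rule ring_ambient)
  show ?thesis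
    by (induction Ks Us rule: combine.induct) (simp_all add: sum.lessThan_Suc_shift del: sum.lessThan_Suc)
qed

lemma independent_imp_lin_indep_on:
  assumes K: "is_subfield K" and ind: "ring.independent ambient K Us"
  shows "lin_indep_on K {..<length Us} (\<lambda>i. Us ! i)"
  unfolding lin_indep_on_def
proof (intro allI impI ballI)
  fix d i
  assume d: "\<forall>i\<in>{..<length Us}. d i \<in> K" "(\<Sum>i<length Us. d i * Us ! i) = 0"
    and i: "i \<in> {..<length Us}"
  have "set (take (length Us) (map d [0..<length Us])) \<subseteq> {\<zero>\<^bsub>ambient\<^esub>}"
    using d by (intro ring.independent_imp_trivial_combine[OF ring_ambient K ind])
      (auto simp: combine_ambient)
  then show "d i = 0" using i by (simp add: image_subset_iff)
qed

lemma Span_ambient_iff: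
  assumes K: "is_subfield K"
  shows "x \<in> ring.Span ambient K Us \<longleftrightarrow>
    (\<exists>d. (\<forall>i<length Us. d i \<in> K) \<and> x = (\<Sum>i<length Us. d i * Us ! i))"
proof -
  have "x \<in> ring.Span ambient K Us \<longleftrightarrow>
      (\<exists>Ks. set Ks \<subseteq> K \<and> length Ks = length Us \<and> x = ring.combine ambient Ks Us)"
    by (rule ring.Span_mem_iff_length_version[OF ring_ambient K]) simp
  also have "\<dots> \<longleftrightarrow> (\<exists>d. (\<forall>i<length Us. d i \<in> K) \<and> x = (\<Sum>i<length Us. d i * Us ! i))"
    (is "?l \<longleftrightarrow> ?r")
  proof
    assume ?l
    then obtain Ks where "set Ks \<subseteq> K" "length Ks = length Us" "x = ring.combine ambient Ks Us"
      by blast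
    then show ?r by (intro exI[of _ "\<lambda>i. Ks ! i"]) (auto simp: combine_ambient)
  next
    assume ?r
    then obtain d where "\<forall>i<length Us. d i \<in> K" "x = (\<Sum>i<length Us. d i * Us ! i)" by blast
    then show ?l by (intro exI[of _ "map d [0..<length Us]"]) (auto simp: combine_ambient)
  qed
  finally show ?thesis .
qed

lemma exists_basis:
  assumes "is_subfield K" "ring.dimension ambient n K V"
  obtains u where "lin_indep_on K {..<n} u"
    "\<And>x. x \<in> V \<longleftrightarrow> (\<exists>d. (\<forall>i<n. d i \<in> K) \<and> x = (\<Sum>i<n. d i * u i))"
proof -
  obtain Us where "ring.independent ambient K Us" "length Us = n" "ring.Span ambient K Us = V"
    using ring.exists_base[OF ring_ambient assms] by blast
  with that[of "\<lambda>i. Us ! i"] show ?thesis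
    using independent_imp_lin_indep_on[OF assms(1)] Span_ambient_iff[OF assms(1), of _ Us] by blast
qed

section \<open>Galois groups and their action through integer powers\<close>

lemma Gal_iff:
  assumes "is_subfield L"
  shows "\<tau> \<in> carrier (Gal L K) \<longleftrightarrow> \<tau> \<in> Bij L \<and> \<tau> 1 = 1 \<and> (\<forall>x\<in>K. \<tau> x = x) \<and>
    (\<forall>x\<in>L. \<forall>y\<in>L. \<tau> (x + y) = \<tau> x + \<tau> y \<and> \<tau> (x * y) = \<tau> x * \<tau> y)"
  by (auto simp: Gal_def ring_iso_def Ring.ring_hom_def Bij_def bij_betw_def)

lemma group_Gal:
  assumes L: "is_subfield L" and "K \<subseteq> L"
  shows "group (Gal L K)"
proof -
  interpret B: group "BijGroup L" by (rule group_BijGroup)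
  have Gal_Bij: "\<tau> \<in> Bij L" if "\<tau> \<in> carrier (Gal L K)" for \<tau>
    using that by (simp add: Gal_iff[OF L])
  have "subgroup (carrier (Gal L K)) (BijGroup L)"
  proof (rule B.subgroupI)
    show "carrier (Gal L K) \<subseteq> carrier (BijGroup L)"
      using Gal_Bij by (auto simp: BijGroup_def)
    have "(\<lambda>x\<in>L. x) \<in> carrier (Gal L K)"
      using assms(2) subfield_intros[OF L] by (auto simp: Gal_iff[OF L] id_Bij)
    then show "carrier (Gal L K) \<noteq> {}" by blast
  next
    fix \<tau> assume \<tau>: "\<tau> \<in> carrier (Gal L K)"
    have bij: "inv_into L \<tau> (\<tau> x) = x" "\<tau> (inv_into L \<tau> x) = x" if "x \<in> L" for x
      using that Gal_Bij[OF \<tau>] by (auto simp: Bij_def bij_betw_inv_into_left bij_betw_inv_into_right)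
    have "inv_into L \<tau> x = x" if "x \<in> L" "\<tau> x = x" for x
      using bij(1)[OF that(1)] that(2) by simp
    then have "(\<lambda>x\<in>L. inv_into L \<tau> x) \<in> carrier (Gal L K)"
      using \<tau> assms(2) Gal_Bij[OF \<tau>] subfield_intros[OF L]
      by (auto simp: Gal_iff[OF L] restrict_inv_into_Bij Bij_imp_funcset Bij_inv_into_mem
          intro!: Bij_inv_into_lemma)
    then show "inv\<^bsub>BijGroup L\<^esub> \<tau> \<in> carrier (Gal L K)"
      by (simp add: inv_BijGroup Gal_Bij[OF \<tau>])
  next
    fix \<tau> \<rho> assume "\<tau> \<in> carrier (Gal L K)" "\<rho> \<in> carrier (Gal L K)"
    then show "\<tau> \<otimes>\<^bsub>BijGroup L\<^esub> \<rho> \<in> carrier (Gal L K)"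
      using assms(2) Bij_imp_funcset[of \<rho> L] subfield_intros[OF L]
      by (auto simp: Gal_iff[OF L] BijGroup_def compose_Bij compose_eq Pi_iff)
  qed
  then have "group (BijGroup L \<lparr>carrier := carrier (Gal L K)\<rparr>)"
    by (rule subgroup.subgroup_is_group) (rule group_BijGroup)
  then show ?thesis by (simp add: Gal_def)
qed

lemma Gal_mult:
  assumes "is_subfield L" "\<tau> \<in> carrier (Gal L K)" "\<rho> \<in> carrier (Gal L K)" "x \<in> L"
  shows "(\<tau> \<otimes>\<^bsub>Gal L K\<^esub> \<rho>) x = \<tau> (\<rho> x)"
  using assms(2-4) by (simp add: Gal_iff[OF assms(1)]) (simp add: Gal_def BijGroup_def compose_eq)

lemma Gal_one: "x \<in> L \<Longrightarrow> \<one>\<^bsub>Gal L K\<^esub> x = x"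
  by (simp add: Gal_def BijGroup_def)

lemma Gal_closed:
  assumes "is_subfield L" "\<tau> \<in> carrier (Gal L K)" "x \<in> L"
  shows "\<tau> x \<in> L"
  using assms(2,3) Bij_imp_funcset[of \<tau> L] by (auto simp: Gal_iff[OF assms(1)])

text \<open>Group powers are taken among functions that are \<open>undefined\<close> outside
  \<open>L\<close>, whereas \<open>^^\<close> iterates on the whole type. Iterates of a point of
  \<open>L\<close> stay in \<open>L\<close>, so the two agree there.\<close>

lemma Gal_pow:
  assumes "is_subfield L" "K \<subseteq> L" "\<tau> \<in> carrier (Gal L K)" "x \<in> L"
  shows "(\<tau> [^]\<^bsub>Gal L K\<^esub> int j) x = (\<tau> ^^ j) x"
proof -
  interpret group "Gal L K" by (rule group_Gal[OF assms(1,2)])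
  have "(\<tau> [^]\<^bsub>Gal L K\<^esub> j) x = (\<tau> ^^ j) x \<and> (\<tau> ^^ j) x \<in> L" for j
  proof (induction j)
    case 0
    show ?case using assms(4) by (simp add: Gal_one)
  next
    case (Suc j)
    have "\<tau> [^]\<^bsub>Gal L K\<^esub> Suc j = \<tau> \<otimes>\<^bsub>Gal L K\<^esub> \<tau> [^]\<^bsub>Gal L K\<^esub> j"
      by (rule nat_pow_Suc2[OF assms(3)])
    then show ?case
      using Suc assms(3,4) by (simp add: Gal_mult[OF assms(1)] Gal_closed[OF assms(1)] del: nat_pow_Suc)
  qed
  then show ?thesis by (simp add: int_pow_int)
qed

text \<open>The elements of \<open>L\<close> fixed by \<open>\<tau>\<close> are closed under the
  field operations. This turns an automorphism that fixes \<open>F\<close> and \<open>K\<close> into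
  the identity on their compositum.\<close>

lemma Gal_fixes_generated_field:
  assumes L: "is_subfield L" and \<tau>: "\<tau> \<in> carrier (Gal L K)"
    and B: "B \<subseteq> L" "\<And>x. x \<in> B \<Longrightarrow> \<tau> x = x"
    and x: "x \<in> generate_field ambient B"
  shows "\<tau> x = x \<and> x \<in> L"
proof -
  have hom: "\<tau> (x + y) = \<tau> x + \<tau> y" "\<tau> (x * y) = \<tau> x * \<tau> y" "\<tau> 1 = 1" if "x \<in> L" "y \<in> L" for x y
    using \<tau> that by (auto simp: Gal_iff[OF L])
  have \<tau>0: "\<tau> 0 = 0" using hom(1)[of 0 0] subfield_0[OF L] by (metis add_0 add_cancel_right_right)
  show ?thesis
    using x
  proof (induction x rule: generate_field.induct)
    case one
    then show ?case using hom(3)[OF subfield_1[OF L] subfield_1[OF L]] by (simp add: subfield_1[OF L])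
  next
    case (incl h)
    then show ?case using B by auto
  next
    case (a_inv h)
    then show ?case
      using hom(1)[of h "- h"] subfield_uminus[OF L, of h] \<tau>0
      by (auto simp: ambient_uminus add_eq_0_iff)
  next
    case (m_inv h)
    then show ?case
      using hom(2,3)[of h "inverse h"] subfield_inverse[OF L, of h]
      by (auto simp: ambient_inverse field_simps)
  next
    case (eng_add h1 h2)
    then show ?case using hom(1) by (simp add: subfield_add[OF L])
  next
    case (eng_mult h1 h2)
    then show ?case using hom(2) by (simp add: subfield_mult[OF L])
  qed
qed

lemma cyclic_action_Gal:
  assumes L: "is_subfield L" and K: "is_subfield K" and K_L: "K \<subseteq> L"
    and \<sigma>: "\<sigma> \<in> carrier (Gal L K)"
    and period: "\<And>x. x \<in> L \<Longrightarrow> (\<sigma> ^^ m) x = x"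
    and fixed: "\<And>x. x \<in> L \<Longrightarrow> \<sigma> x = x \<Longrightarrow> x \<in> K"
  shows "cyclic_action L K (\<lambda>t::int. \<sigma> [^]\<^bsub>Gal L K\<^esub> t) m"
proof -
  interpret group "Gal L K" by (rule group_Gal[OF L K_L])
  have pow: "\<sigma> [^]\<^bsub>Gal L K\<^esub> (t::int) \<in> carrier (Gal L K)" for t
    using \<sigma> by (rule int_pow_closed)
  have hom: "(\<sigma> [^]\<^bsub>Gal L K\<^esub> t) (x + y) = (\<sigma> [^]\<^bsub>Gal L K\<^esub> t) x + (\<sigma> [^]\<^bsub>Gal L K\<^esub> t) y"
    "(\<sigma> [^]\<^bsub>Gal L K\<^esub> t) (x * y) = (\<sigma> [^]\<^bsub>Gal L K\<^esub> t) x * (\<sigma> [^]\<^bsub>Gal L K\<^esub> t) y"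
    if "x \<in> L" "y \<in> L" for x y and t :: int
    using pow[of t] that by (simp_all add: Gal_iff[OF L])
  show ?thesis
  proof (rule cyclic_action.intro)
    show "(\<sigma> [^]\<^bsub>Gal L K\<^esub> t) x \<in> L" if "x \<in> L" for x and t :: int
      using Gal_closed[OF L pow that] .
    show "(\<sigma> [^]\<^bsub>Gal L K\<^esub> (0::int)) x = x" if "x \<in> L" for x
      using that by (simp add: Gal_one)
    show "(\<sigma> [^]\<^bsub>Gal L K\<^esub> t) ((\<sigma> [^]\<^bsub>Gal L K\<^esub> u) x) = (\<sigma> [^]\<^bsub>Gal L K\<^esub> (t + u)) x"
      if "x \<in> L" for x and t u :: int
      by (simp add: int_pow_mult[OF \<sigma>] Gal_mult[OF L pow pow that])
    show "(\<sigma> [^]\<^bsub>Gal L K\<^esub> t) x = x" if "x \<in> K" for x and t :: int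
      using pow[of t] that by (simp add: Gal_iff[OF L])
    show "(\<sigma> [^]\<^bsub>Gal L K\<^esub> int m) x = x" if "x \<in> L" for x
      by (simp add: Gal_pow[OF L K_L \<sigma> that] period[OF that])
    show "x \<in> K" if "x \<in> L" "(\<sigma> [^]\<^bsub>Gal L K\<^esub> (1::int)) x = x" for x
      using that fixed by (simp add: int_pow_1[OF \<sigma>])
  qed (fact L K K_L hom)+
qed

text \<open>A fixed element has constant coordinates in the normal basis, so it is a multiple of the trace of \<open>\<beta>\<close>.\<close>

lemma fixed_field_normal_element:
  assumes L: "is_subfield L" and K: "is_subfield K" and K_L: "K \<subseteq> L"
    and \<sigma>: "\<sigma> \<in> carrier (Gal L K)" and period: "\<And>x. x \<in> L \<Longrightarrow> (\<sigma> ^^ m) x = x"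
    and normal: "normal_element L K \<sigma> m \<beta>"
    and x: "x \<in> L" "\<sigma> x = x"
  shows "x \<in> K"
proof -
  define B where "B = map (\<lambda>j. (\<sigma> ^^ j) \<beta>) [0..<m]"
  have \<beta>: "\<beta> \<in> L" and basis: "lin_indep_on K {..<m} (\<lambda>j. B ! j)" and
    span: "\<And>y. y \<in> L \<longleftrightarrow> (\<exists>d. (\<forall>j<m. d j \<in> K) \<and> y = (\<Sum>j<m. d j * B ! j))"
    using normal independent_imp_lin_indep_on[OF K, of B] Span_ambient_iff[OF K, of _ B]
    by (simp_all add: normal_element_def is_basis_def flip: B_def) (simp_all add: B_def)
  have \<sigma>_L: "(\<sigma> ^^ j) \<beta> \<in> L" for j
    using \<beta> Gal_closed[OF L \<sigma>] by (induction j) auto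
  have hom: "\<sigma> (y + z) = \<sigma> y + \<sigma> z" "\<sigma> (y * z) = \<sigma> y * \<sigma> z" if "y \<in> L" "z \<in> L" for y z
    using \<sigma> that by (auto simp: Gal_iff[OF L])
  have \<sigma>_K: "\<sigma> y = y" if "y \<in> K" for y
    using \<sigma> that by (auto simp: Gal_iff[OF L])
  have \<sigma>_sum: "\<sigma> (\<Sum>j<n. f j) = (\<Sum>j<n. \<sigma> (f j))" if "\<And>j. j < n \<Longrightarrow> f j \<in> L" for f :: "nat \<Rightarrow> 'a" and n
    using that
  proof (induction n)
    case (Suc n)
    then have "(\<Sum>j<n. f j) \<in> L" by (intro subfield_sum[OF L]) auto
    with Suc show ?case by (simp add: hom)
  qed (simp add: \<sigma>_K[OF subfield_0[OF K]])
  define T where "T = (\<Sum>j<m. (\<sigma> ^^ j) \<beta>)"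
  have multiple: "\<exists>c\<in>K. y = c * T" if y: "y \<in> L" "\<sigma> y = y" for y
  proof -
    obtain d where d: "\<And>j. j < m \<Longrightarrow> d j \<in> K" "y = (\<Sum>j<m. d j * B ! j)"
      using span y(1) by blast
    have y_eq: "y = (\<Sum>j<m. d j * (\<sigma> ^^ j) \<beta>)" using d(2) by (simp add: B_def)
    show ?thesis
    proof (cases m)
      case 0
      then show ?thesis using y_eq subfield_0[OF K] by auto
    next
      case (Suc p)
      \<comment> \<open>Coordinate \<open>j\<close> is compared with its cyclic predecessor; the
        wrap-around from \<open>p = m - 1\<close> to 0 comes from \<open>\<sigma>^m\<close> fixing
        \<open>\<beta>\<close>.\<close>
      define e where "e = (\<lambda>j. d j - d (if j = 0 then p else j - 1))"
      have "y = \<sigma> (\<Sum>j<m. d j * (\<sigma> ^^ j) \<beta>)" using y y_eq by simp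
      also have "\<dots> = (\<Sum>j<m. \<sigma> (d j * (\<sigma> ^^ j) \<beta>))"
        using d(1) K_L \<sigma>_L by (intro \<sigma>_sum subfield_mult[OF L]) auto
      also have "\<dots> = (\<Sum>j<m. d j * (\<sigma> ^^ Suc j) \<beta>)"
      proof (rule sum.cong[OF refl])
        fix j assume "j \<in> {..<m}"
        then have "d j \<in> K" "d j \<in> L" using d(1)[of j] K_L by auto
        then show "\<sigma> (d j * (\<sigma> ^^ j) \<beta>) = d j * (\<sigma> ^^ Suc j) \<beta>"
          by (simp add: hom(2)[OF _ \<sigma>_L] \<sigma>_K)
      qed
      also have "\<dots> = (\<Sum>j<p. d j * (\<sigma> ^^ Suc j) \<beta>) + d p * \<beta>"
        using period[OF \<beta>] by (simp add: Suc)
      finally have y_eq': "y = (\<Sum>j<p. d j * (\<sigma> ^^ Suc j) \<beta>) + d p * \<beta>" .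
      have "0 = (\<Sum>j<m. d j * (\<sigma> ^^ j) \<beta>) - ((\<Sum>j<p. d j * (\<sigma> ^^ Suc j) \<beta>) + d p * \<beta>)"
        unfolding y_eq[symmetric] y_eq'[symmetric] by simp
      also have "\<dots> = (\<Sum>j<m. e j * (\<sigma> ^^ j) \<beta>)"
        unfolding Suc sum.lessThan_Suc_shift by (simp add: e_def algebra_simps sum_subtractf)
      also have "\<dots> = (\<Sum>j<m. e j * B ! j)" by (simp add: B_def)
      finally have "(\<Sum>j<m. e j * B ! j) = 0" by simp
      moreover have "e j \<in> K" if "j < m" for j
        using that Suc by (auto simp: e_def intro!: subfield_diff[OF K] d(1))
      ultimately have e: "e j = 0" if "j < m" for j
        using lin_indep_onD[OF basis, of e j] that by simp
      have d_eq: "d j = d 0" if "j < m" for j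
        using that
      proof (induction j)
        case (Suc j)
        then show ?case using e[of "Suc j"] by (simp add: e_def)
      qed simp
      have "y = d 0 * T"
        unfolding y_eq T_def sum_distrib_left
      proof (rule sum.cong[OF refl])
        fix j assume "j \<in> {..<m}"
        then show "d j * (\<sigma> ^^ j) \<beta> = d 0 * (\<sigma> ^^ j) \<beta>" using d_eq[of j] by simp
      qed
      then show ?thesis using d(1)[of 0] Suc by blast
    qed
  qed
  \<comment> \<open>The fixed element 1 is itself a multiple of the trace \<open>T\<close>, so
    \<open>T\<close> is the inverse of an element of \<open>K\<close>.\<close>
  obtain c where "c \<in> K" "1 = c * T"
    using multiple[of 1] subfield_1[OF L] \<sigma>_K[OF subfield_1[OF K]] by blast
  moreover from \<open>1 = c * T\<close> have "inverse c = T" by (intro inverse_unique) simp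
  ultimately have "T \<in> K" using subfield_inverse[OF K, of c] by simp
  moreover obtain c' where "c' \<in> K" "x = c' * T" using multiple[OF x] by blast
  ultimately show ?thesis by (simp add: subfield_mult[OF K])
qed

section \<open>Independence over the fields \<open>E\<close>, \<open>F\<close> and \<open>K\<close>,
  and the rank of a word\<close>

text \<open>
  Coordinates with respect to an \<open>F\<close>-basis of \<open>L\<close> reduce a relation over \<open>K\<close> to relations over \<open>F\<close>;
  the latter hold for all conjugates, so the Moore matrix over \<open>F\<close> applies.
\<close>

lemma lin_indep_on_linearly_disjoint:
  fixes w :: nat
  assumes LK: "cyclic_action L K S m" and FE: "cyclic_action F E T m"
    and F_L: "has_degree L F h"
    and S_T: "\<And>n x. x \<in> F \<Longrightarrow> S (int n) x = T (int n) x"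
    and g: "\<And>i. i < w \<Longrightarrow> g i \<in> F" "lin_indep_on E {..<w} g"
  shows "lin_indep_on K {..<w} g"
  unfolding lin_indep_on_def
proof (intro allI impI)
  interpret LK: cyclic_action L K S m by fact
  interpret FE: cyclic_action F E T m by fact
  have F_L': "F \<subseteq> L" using F_L by simp
  fix d
  assume d: "\<forall>i\<in>{..<w}. d i \<in> K" "(\<Sum>i<w. d i * g i) = 0"
  obtain u where u: "lin_indep_on F {..<h} u"
      "\<And>x. x \<in> L \<longleftrightarrow> (\<exists>f. (\<forall>b<h. f b \<in> F) \<and> x = (\<Sum>b<h. f b * u b))"
    by (rule exists_basis[OF FE.L conjunct2[OF F_L]]; rule that; assumption)
  have "\<exists>f. (\<forall>b<h. f b \<in> F) \<and> d i = (\<Sum>b<h. f b * u b)" if "i < w" for i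
  proof -
    have "d i \<in> L" using d(1) that LK.K_L by auto
    then show ?thesis by (simp only: u(2))
  qed
  then have "\<forall>i. \<exists>f. i < w \<longrightarrow> (\<forall>b<h. f b \<in> F) \<and> d i = (\<Sum>b<h. f b * u b)" by blast
  then obtain f where "\<forall>i. i < w \<longrightarrow> (\<forall>b<h. f i b \<in> F) \<and> d i = (\<Sum>b<h. f i b * u b)"
    by (rule choice[THEN exE])
  then have f: "\<And>i b. i < w \<Longrightarrow> b < h \<Longrightarrow> f i b \<in> F"
      "\<And>i. i < w \<Longrightarrow> d i = (\<Sum>b<h. f i b * u b)"
    by blast+
  \<comment> \<open>\<open>S (int n)\<close> fixes the \<open>d i\<close> and conjugates the
    \<open>g i\<close>; independence of \<open>u\<close> over \<open>F\<close> then separates the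
    relation into one for each coordinate \<open>b\<close>.\<close>
  have relF: "(\<Sum>i<w. f i b * T (int n) (g i)) = 0" if b: "b < h" for b n
  proof -
    have "0 = S (int n) (\<Sum>i<w. d i * g i)" using d(2) by (simp add: LK.S_zero)
    also have "\<dots> = (\<Sum>i<w. S (int n) (d i * g i))"
      using d(1) g(1) F_L' LK.K_L by (intro LK.S_sum subfield_mult[OF LK.L]) auto
    also have "\<dots> = (\<Sum>i<w. d i * T (int n) (g i))"
    proof (rule sum.cong[OF refl])
      fix i assume "i \<in> {..<w}"
      then have "d i \<in> K" "g i \<in> F" "g i \<in> L" using d(1) g(1) F_L' by auto
      then show "S (int n) (d i * g i) = d i * T (int n) (g i)"
        by (simp add: LK.S_times_K S_T)
    qed
    also have "\<dots> = (\<Sum>i<w. \<Sum>b<h. f i b * T (int n) (g i) * u b)"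
      by (intro sum.cong) (simp_all add: f(2) sum_distrib_left sum_distrib_right mult_ac)
    also have "\<dots> = (\<Sum>b<h. (\<Sum>i<w. f i b * T (int n) (g i)) * u b)"
      by (subst sum.swap) (simp add: sum_distrib_right)
    finally have "(\<Sum>b<h. (\<Sum>i<w. f i b * T (int n) (g i)) * u b) = 0" by simp
    moreover have "(\<Sum>i<w. f i b * T (int n) (g i)) \<in> F" if "b < h" for b
      using that f(1) g(1) by (intro subfield_sum[OF FE.L] subfield_mult[OF FE.L] FE.S_closed) auto
    ultimately show ?thesis
      using lin_indep_onD[OF u(1), of "\<lambda>b. \<Sum>i<w. f i b * T (int n) (g i)" b] b by simp
  qed
  \<comment> \<open>With all multipliers equal to 1 there is a single class, and the system is a
    pure Moore system for F/E.\<close>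
  have "\<forall>i\<in>{..<w}. f i b = 0" if b: "b < h" for b
  proof (rule FE.moore_vandermonde[where e = 1 and q = 0 and \<eta> = "\<lambda>_. 1" and g = g])
    show "lin_indep_on E {i \<in> {..<w}. (1::'a) = z} g" for z
      using g(2) by (cases "1 = z") (simp_all add: lin_indep_on_empty lessThan_def)
    show "(\<Sum>i<w. f i b * 1 powi (0 + int n) * T (1 * (0 + int n)) (g i)) = 0" for n
      using relF[OF b, of n] by simp
  qed (use f(1) g(1) b subfield_1[OF FE.K] in auto)
  then show "\<forall>i\<in>{..<w}. d i = 0" by (simp add: f(2))
qed

text \<open>A full-rank factorization of \<open>v\<close> through a basis \<open>c\<close> of the
  span of its entries. The last property puts each \<open>c i\<close> back into that span, which
  later yields a right inverse of \<open>e\<close>.\<close>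

lemma rank_factorization:
  fixes v :: "'a::field vec"
  assumes E: "is_subfield E" and w: "w = rank_weight E v"
  obtains c e where "lin_indep_on E {..<w} c"
    "\<And>i j. i < w \<Longrightarrow> j < dim_vec v \<Longrightarrow> e i j \<in> E"
    "\<And>j. j < dim_vec v \<Longrightarrow> v $ j = (\<Sum>i<w. e i j * c i)"
    "\<And>i. i < w \<Longrightarrow> \<exists>f. (\<forall>j<dim_vec v. f j \<in> E) \<and> c i = (\<Sum>j<dim_vec v. f j * v $ j)"
proof -
  interpret ring "ambient :: 'a ring" by (rule ring_ambient)
  define V where "V = Span E (list_of_vec v)"
  have span_v: "x \<in> V \<longleftrightarrow> (\<exists>f. (\<forall>j<dim_vec v. f j \<in> E) \<and> x = (\<Sum>j<dim_vec v. f j * v $ j))" for x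
    unfolding V_def Span_ambient_iff[OF E] by (simp add: list_of_vec_index)
  have "finite_dimension E V"
    unfolding V_def by (rule Span_finite_dimension[OF E]) simp
  then have dim_V: "dimension w E V"
    using finite_dimensionE[OF E] by (simp add: w rank_weight_def V_def over_def)
  obtain c where c: "lin_indep_on E {..<w} c"
      "\<And>x. x \<in> V \<longleftrightarrow> (\<exists>d. (\<forall>i<w. d i \<in> E) \<and> x = (\<Sum>i<w. d i * c i))"
    by (rule exists_basis[OF E dim_V]; rule that; assumption)
  have v_V: "v $ j \<in> V" if "j < dim_vec v" for j
    unfolding span_v
    using that subfield_0[OF E] subfield_1[OF E]
    by (intro exI[of _ "\<lambda>i. if i = j then 1 else 0"]) (simp add: sum_unit_vector)
  then have "\<forall>j. \<exists>d. j < dim_vec v \<longrightarrow> (\<forall>i<w. d i \<in> E) \<and> v $ j = (\<Sum>i<w. d i * c i)"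
    unfolding c(2) by blast
  then obtain e where "\<forall>j. j < dim_vec v \<longrightarrow> (\<forall>i<w. e j i \<in> E) \<and> v $ j = (\<Sum>i<w. e j i * c i)"
    by (rule choice[THEN exE])
  then have e: "\<And>i j. i < w \<Longrightarrow> j < dim_vec v \<Longrightarrow> e j i \<in> E"
      "\<And>j. j < dim_vec v \<Longrightarrow> v $ j = (\<Sum>i<w. e j i * c i)"
    by blast+
  have c_V: "c i \<in> V" if "i < w" for i
    unfolding c(2)
    using that subfield_0[OF E] subfield_1[OF E]
    by (intro exI[of _ "\<lambda>p. if p = i then 1 else 0"]) (simp add: sum_unit_vector)
  show ?thesis
  proof (rule that[of c "\<lambda>i j. e j i"])
    show "\<exists>f. (\<forall>j<dim_vec v. f j \<in> E) \<and> c i = (\<Sum>j<dim_vec v. f j * v $ j)" if "i < w" for i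
      using c_V[OF that] by (simp only: span_v)
  qed (fact c(1) e)+
qed

text \<open>
  \<open>e\<close> is the \<open>w \<times> n\<close> coordinate matrix of \<open>v\<close> in the basis \<open>c\<close> of the span of its entries; it has a
  right inverse over \<open>E\<close>, hence its rows stay independent over every larger field.
\<close>

lemma lin_indep_on_rank_factor:
  fixes w n :: nat and c u :: "nat \<Rightarrow> 'a::field"
  assumes E: "is_subfield E" and K: "is_subfield K" and E_K: "E \<subseteq> K"
    and c: "lin_indep_on E {..<w} c"
    and e: "\<And>i j. i < w \<Longrightarrow> j < n \<Longrightarrow> e i j \<in> E"
    and v: "\<And>j. j < n \<Longrightarrow> v j = (\<Sum>i<w. e i j * c i)"
    and c_span: "\<And>i. i < w \<Longrightarrow> \<exists>f. (\<forall>j<n. f j \<in> E) \<and> c i = (\<Sum>j<n. f j * v j)"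
    and u: "lin_indep_on K {..<n} u"
  shows "lin_indep_on K {..<w} (\<lambda>i. \<Sum>j<n. e i j * u j)"
  unfolding lin_indep_on_def
proof (intro allI impI ballI)
  fix d p
  assume d: "\<forall>i\<in>{..<w}. d i \<in> K" "(\<Sum>i<w. d i * (\<Sum>j<n. e i j * u j)) = 0"
    and p: "p \<in> {..<w}"
  have "(\<Sum>i<w. d i * (\<Sum>j<n. e i j * u j)) = (\<Sum>j<n. (\<Sum>i<w. d i * e i j) * u j)"
    unfolding sum_distrib_left sum_distrib_right by (subst sum.swap) (simp add: mult_ac)
  with d(2) have u_rel: "(\<Sum>j<n. (\<Sum>i<w. d i * e i j) * u j) = 0" by simp
  have "(\<Sum>i<w. d i * e i j) \<in> K" if "j < n" for j
    using that d(1) e E_K by (intro subfield_sum[OF K] subfield_mult[OF K]) auto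
  then have de: "(\<Sum>i<w. d i * e i j) = 0" if "j < n" for j
    using lin_indep_onD[OF u _ u_rel, of j] that by simp
  obtain f where f: "\<And>j. j < n \<Longrightarrow> f j \<in> E" "c p = (\<Sum>j<n. f j * v j)"
    using c_span[of p] p by auto
  \<comment> \<open>Expanding the \<open>v j\<close> in the formula for \<open>c p\<close> and
    comparing coefficients of the independent \<open>c\<close> shows that \<open>f\<close> is column
    \<open>p\<close> of a right inverse of \<open>e\<close>. Hence \<open>d p\<close> is the product
    of the zero row \<open>de\<close> with \<open>f\<close>.\<close>
  define g where "g = (\<lambda>i. (\<Sum>j<n. f j * e i j) - (if i = p then 1 else 0))"
  have "(\<Sum>j<n. f j * v j) = (\<Sum>j<n. \<Sum>i<w. f j * e i j * c i)"
    by (simp add: v sum_distrib_left mult.assoc)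
  also have "\<dots> = (\<Sum>i<w. (\<Sum>j<n. f j * e i j) * c i)"
    by (subst sum.swap) (simp add: sum_distrib_right)
  finally have "(\<Sum>i<w. (\<Sum>j<n. f j * e i j) * c i) - c p = 0" using f(2) by simp
  moreover have "(\<Sum>i<w. (if i = p then 1 else 0) * c i) = c p"
    using p by (intro sum_unit_vector) auto
  ultimately have "(\<Sum>i<w. g i * c i) = 0"
    by (simp add: g_def left_diff_distrib sum_subtractf)
  moreover have "g i \<in> E" if "i < w" for i
    unfolding g_def using that f(1) e
    by (intro subfield_diff[OF E] subfield_sum[OF E] subfield_mult[OF E])
      (auto simp: subfield_0[OF E] subfield_1[OF E])
  ultimately have "g i = 0" if "i < w" for i
    using lin_indep_onD[OF c, of g i] that by simp
  then have fe: "(\<Sum>j<n. f j * e i j) = (if i = p then 1 else 0)" if "i < w" for i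
    using that by (simp add: g_def)
  have "d p = (\<Sum>i<w. (if i = p then 1 else 0) * d i)"
    using p by (simp add: sum_unit_vector)
  also have "\<dots> = (\<Sum>i<w. \<Sum>j<n. f j * (d i * e i j))"
    by (intro sum.cong) (auto simp: fe[symmetric] sum_distrib_left mult_ac)
  also have "\<dots> = (\<Sum>j<n. f j * (\<Sum>i<w. d i * e i j))"
    by (subst sum.swap) (simp add: sum_distrib_left)
  also have "\<dots> = 0" by (simp add: de)
  finally show "d p = 0" .
qed

section \<open>Codes\<close>

lemma poly_poly_of_word: "poly (poly_of_word u) x = (\<Sum>i<dim_vec u. u $ i * x ^ i)"
  by (simp add: poly_of_word_def poly_sum poly_monom)

lemma zero_in_polys_over: "is_subfield F \<Longrightarrow> 0 \<in> polys_over F"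
  by (simp add: polys_over_def subfield_0)

lemma pow_minus_one_in_polys_over: "is_subfield F \<Longrightarrow> pow_minus_one n \<in> polys_over F"
  by (auto simp: polys_over_def subfield_intros)

text \<open>A codeword is a multiple of \<open>f\<close> modulo \<open>x^l - 1\<close>, and both
  polynomials vanish at \<open>x\<close>.\<close>

lemma codeword_root:
  assumes F: "is_subfield F" and f: "generator_poly F l C f" and u: "u \<in> C"
    and x: "x \<in> T_H K l f"
  shows "poly (poly_of_word u) x = 0"
proof -
  have "poly_of_word u \<in> {poly_of_word u + h * pow_minus_one l |u h. u \<in> C \<and> h \<in> polys_over F}"
    using u zero_in_polys_over[OF F] by (intro CollectI exI[of _ u] exI[of _ 0]) simp
  then obtain g h where "poly_of_word u = g * f + h * pow_minus_one l"
    using f unfolding generator_poly_def by auto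
  then show ?thesis
    using x by (simp add: T_H_def roots_of_unity_in_def poly_monom)
qed

text \<open>The value at \<open>y\<close> of the operator \<open>f(\<sigma>)\<close>; for nonzero
  \<open>y\<close> it is \<open>Ev \<sigma> y f * y\<close>. Without the factor
  \<open>inverse y\<close>, products of skew polynomials become compositions.\<close>

definition skew_eval :: "('a::field \<Rightarrow> 'a) \<Rightarrow> 'a poly \<Rightarrow> 'a \<Rightarrow> 'a" where
  "skew_eval \<sigma> f y = (\<Sum>j\<le>degree f. coeff f j * (\<sigma> ^^ j) y)"

lemma skew_eval_le:
  assumes "degree f \<le> n"
  shows "skew_eval \<sigma> f y = (\<Sum>j\<le>n. coeff f j * (\<sigma> ^^ j) y)"
  unfolding skew_eval_def using assms
  by (intro sum.mono_neutral_left) (auto intro: coeff_eq_0)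

lemma skew_eval_0 [simp]: "skew_eval \<sigma> 0 y = 0"
  by (simp add: skew_eval_def)

lemma skew_eval_add: "skew_eval \<sigma> (f + g) y = skew_eval \<sigma> f y + skew_eval \<sigma> g y"
proof -
  define n where "n = max (degree f) (degree g)"
  have "degree (f + g) \<le> n" "degree f \<le> n" "degree g \<le> n"
    by (simp_all add: n_def degree_add_le_max)
  then show ?thesis by (simp add: skew_eval_le sum.distrib distrib_right)
qed

lemma skew_eval_sum: "skew_eval \<sigma> (\<Sum>i\<in>A. f i) y = (\<Sum>i\<in>A. skew_eval \<sigma> (f i) y)"
  by (induction A rule: infinite_finite_induct) (simp_all add: skew_eval_add)

lemma skew_eval_monom: "skew_eval \<sigma> (Polynomial.monom c n) y = c * (\<sigma> ^^ n) y"
proof -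
  have "skew_eval \<sigma> (Polynomial.monom c n) y = (\<Sum>j\<le>n. coeff (Polynomial.monom c n) j * (\<sigma> ^^ j) y)"
    by (rule skew_eval_le) (rule degree_monom_le)
  also have "\<dots> = (\<Sum>j\<in>{n}. coeff (Polynomial.monom c n) j * (\<sigma> ^^ j) y)"
    by (rule sum.mono_neutral_right) auto
  finally show ?thesis by simp
qed

lemma skew_eval_poly_of_word:
  "skew_eval \<sigma> (poly_of_word v) y = (\<Sum>j<dim_vec v. v $ j * (\<sigma> ^^ j) y)"
  by (simp add: poly_of_word_def skew_eval_sum skew_eval_monom)

lemma skew_eval_pow_minus_one:
  "skew_eval \<sigma> (pow_minus_one n) y = (\<sigma> ^^ n) y - (y :: 'a::field)"
proof -
  have *: "pow_minus_one n = Polynomial.monom 1 n + Polynomial.monom (- 1 :: 'a) 0"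
    by (simp add: monom_0 one_pCons)
  show ?thesis unfolding * skew_eval_add skew_eval_monom by simp
qed

lemma skew_eval_eq_0_if_T_rk:
  assumes "y \<in> T_rk L \<sigma> f"
  shows "skew_eval \<sigma> f y = 0"
proof -
  have "skew_eval \<sigma> f y * inverse y = 0"
    using assms by (simp add: T_rk_def Ev_def skew_eval_def sum_distrib_right)
  then show ?thesis using assms by (simp add: T_rk_def)
qed

text \<open>The rule \<open>z \<alpha> = \<theta>(\<alpha>) z\<close> becomes
  \<open>\<sigma>(\<alpha> y) = \<theta>(\<alpha>) \<sigma>(y)\<close>, valid since
  \<open>\<theta>\<close> agrees with \<open>\<sigma>\<close> on \<open>F\<close>.\<close>

lemma skew_eval_skew_mult:
  assumes "cyclic_action L K S m" and F_L: "F \<subseteq> L"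
    and \<sigma>: "\<And>j x. x \<in> L \<Longrightarrow> S (int j) x = (\<sigma> ^^ j) x"
    and \<theta>: "\<And>j x. x \<in> F \<Longrightarrow> (\<theta> ^^ j) x = (\<sigma> ^^ j) x"
    and f: "f \<in> polys_over F" and y: "y \<in> L"
  shows "skew_eval \<sigma> (skew_mult \<theta> g f) y = skew_eval \<sigma> g (skew_eval \<sigma> f y)"
proof -
  interpret cyclic_action L K S m by fact
  have f_F: "coeff f j \<in> F" for j using f by (simp add: polys_over_def)
  then have f_L: "coeff f j \<in> L" for j using F_L by blast
  have \<sigma>_L: "(\<sigma> ^^ j) y \<in> L" for j using S_closed[OF y, of "int j"] by (simp add: \<sigma> y)
  have step: "(\<Sum>j\<le>degree f. (\<theta> ^^ i) (coeff f j) * (\<sigma> ^^ (i + j)) y) = (\<sigma> ^^ i) (skew_eval \<sigma> f y)" for i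
  proof -
    have eval_L: "skew_eval \<sigma> f y \<in> L"
      unfolding skew_eval_def by (intro subfield_sum[OF L] subfield_mult[OF L] f_L \<sigma>_L)
    have "(\<sigma> ^^ i) (skew_eval \<sigma> f y) = S (int i) (skew_eval \<sigma> f y)"
      using \<sigma>[OF eval_L] by simp
    also have "\<dots> = (\<Sum>j\<le>degree f. S (int i) (coeff f j * (\<sigma> ^^ j) y))"
      unfolding skew_eval_def by (intro S_sum subfield_mult[OF L] f_L \<sigma>_L)
    also have "\<dots> = (\<Sum>j\<le>degree f. (\<theta> ^^ i) (coeff f j) * (\<sigma> ^^ (i + j)) y)"
      by (intro sum.cong refl) (simp add: S_times f_L \<sigma>_L \<sigma> \<theta> f_F funpow_add)
    finally show ?thesis by simp
  qed
  have "skew_eval \<sigma> (skew_mult \<theta> g f) y =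
      (\<Sum>i\<le>degree g. coeff g i * (\<Sum>j\<le>degree f. (\<theta> ^^ i) (coeff f j) * (\<sigma> ^^ (i + j)) y))"
    by (simp add: skew_mult_def skew_eval_sum skew_eval_monom sum_distrib_left mult.assoc)
  also have "\<dots> = skew_eval \<sigma> g (skew_eval \<sigma> f y)"
    by (simp add: step) (simp add: skew_eval_def)
  finally show ?thesis .
qed

text \<open>As a skew polynomial a codeword is \<open>g f + h (z^m - 1)\<close>, and the right
  factors \<open>f\<close> and \<open>z^m - 1\<close> both send \<open>y\<close> to 0 as
  operators.\<close>

lemma skew_codeword_root:
  assumes act: "cyclic_action L K S m" and F: "is_subfield F" and F_L: "F \<subseteq> L"
    and \<sigma>: "\<And>j x. x \<in> L \<Longrightarrow> S (int j) x = (\<sigma> ^^ j) x"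
    and \<theta>: "\<And>j x. x \<in> F \<Longrightarrow> (\<theta> ^^ j) x = (\<sigma> ^^ j) x"
    and f: "skew_generator_poly F \<theta> m C f" and v: "v \<in> C"
    and y: "y \<in> T_rk L \<sigma> f"
  shows "skew_eval \<sigma> (poly_of_word v) y = 0"
proof -
  interpret cyclic_action L K S m by fact
  have y_L: "y \<in> L" using y by (simp add: T_rk_def)
  have mult: "skew_eval \<sigma> (skew_mult \<theta> g q) y = skew_eval \<sigma> g (skew_eval \<sigma> q y)"
    if "q \<in> polys_over F" for g q
    by (rule skew_eval_skew_mult[OF act F_L \<sigma> \<theta> that y_L])
  have \<sigma>0: "skew_eval \<sigma> g 0 = 0" for g
  proof -
    have "(\<sigma> ^^ j) 0 = 0" for j
      using \<sigma>[OF subfield_0[OF L]] by (simp add: S_zero flip: \<sigma>)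
    then show ?thesis by (simp add: skew_eval_def)
  qed
  have "skew_mult \<theta> 0 (pow_minus_one m) = 0" by (simp add: skew_mult_def)
  then have "poly_of_word v \<in>
      {poly_of_word v + skew_mult \<theta> h (pow_minus_one m) |v h. v \<in> C \<and> h \<in> polys_over F}"
    using v zero_in_polys_over[OF F] by (intro CollectI exI[of _ v] exI[of _ 0]) simp
  then obtain g h where "poly_of_word v = skew_mult \<theta> g f + skew_mult \<theta> h (pow_minus_one m)"
    using f unfolding skew_generator_poly_def by auto
  then have "skew_eval \<sigma> (poly_of_word v) y =
      skew_eval \<sigma> g (skew_eval \<sigma> f y) + skew_eval \<sigma> h ((\<sigma> ^^ m) y - y)"
    using f by (simp add: skew_eval_add mult skew_generator_poly_def
        pow_minus_one_in_polys_over[OF F] skew_eval_pow_minus_one)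
  also have "(\<sigma> ^^ m) y = y" using \<sigma>[OF y_L, of m] S_period[OF y_L] by simp
  finally show ?thesis by (simp add: skew_eval_eq_0_if_T_rk[OF y] \<sigma>0)
qed

lemma min_distance_attained:
  assumes "linear_code F n C" "C \<noteq> {0\<^sub>v n}"
  obtains u where "u \<in> C" "u \<in> words F n" "u \<noteq> 0\<^sub>v n" "min_distance wt C = wt u"
proof -
  have C: "C \<subseteq> words F n" "0\<^sub>v n \<in> C" using assms(1) by (auto simp: linear_code_def)
  have dim: "dim_vec u = n" if "u \<in> C" for u
    using that C by (auto simp: words_def)
  obtain u where "u \<in> C" "u \<noteq> 0\<^sub>v n" using assms(2) C(2) by blast
  then have "{wt v |v. v \<in> C \<and> v \<noteq> 0\<^sub>v (dim_vec v)} \<noteq> {}" using dim by blast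
  then have "min_distance wt C \<in> {wt v |v. v \<in> C \<and> v \<noteq> 0\<^sub>v (dim_vec v)}"
    unfolding min_distance_def by (rule Inf_nat_def1)
  then obtain u where "min_distance wt C = wt u" "u \<in> C" "u \<noteq> 0\<^sub>v (dim_vec u)" by blast
  then show ?thesis using that[of u] dim[of u] C(1) by auto
qed

section \<open>Powers of a primitive root of unity\<close>

lemma primitive_root_power_int_eq_1:
  assumes a: "primitive_root_of_unity l a" and z: "a powi z = 1"
  shows "int l dvd z"
proof -
  have l: "l > 0" and al: "a ^ l = 1" and min: "\<And>n. 0 < n \<Longrightarrow> n < l \<Longrightarrow> a ^ n \<noteq> 1"
    using a by (auto simp: primitive_root_of_unity_def)
  have a0: "a \<noteq> 0" using al l by (auto simp: zero_power)
  have "1 = a powi (int l * (z div int l) + z mod int l)" using z by simp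
  also have "\<dots> = a powi (z mod int l)"
    unfolding power_int_add[OF disjI1[OF a0]] power_int_mult by (simp add: al)
  also have "\<dots> = a ^ nat (z mod int l)" using l by (simp add: power_int_def)
  finally have "a ^ nat (z mod int l) = 1" by simp
  moreover have "nat (z mod int l) < l" using l by (simp add: nat_less_iff)
  ultimately have "nat (z mod int l) = 0" using min by blast
  then show ?thesis using l by (metis dvd_eq_mod_eq_0 nat_0_iff of_nat_0_less_iff order_antisym pos_mod_sign)
qed

text \<open>Needed with \<open>e\<close> equal to 1, \<open>m\<close> and \<open>s * m\<close>, all
  coprime to \<open>l\<close>: the powers of \<open>a\<close> attached to the positions of a word
  stay distinct after raising to the \<open>e\<close>-th power.\<close>

lemma primitive_root_inj:
  assumes a: "primitive_root_of_unity l a" and e: "coprime e (int l)"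
  shows "inj_on (\<lambda>i. a powi (e * int i)) {..<l}"
proof (rule inj_onI)
  fix i j assume ij: "i \<in> {..<l}" "j \<in> {..<l}" and eq: "a powi (e * int i) = a powi (e * int j)"
  have a0: "a \<noteq> 0" using a by (auto simp: primitive_root_of_unity_def zero_power)
  have "a powi (e * (int i - int j)) = a powi (e * int i) / a powi (e * int j)"
    using a0 by (simp add: right_diff_distrib power_int_diff)
  also have "\<dots> = 1" using eq a0 by simp
  finally have "int l dvd e * (int i - int j)" by (rule primitive_root_power_int_eq_1[OF a])
  then have "int l dvd int i - int j" using e by (simp add: coprime_dvd_mult_right_iff coprime_commute)
  then have "int i mod int l = int j mod int l" by (simp add: mod_eq_dvd_iff)
  then show "i = j" using ij by simp
qed

text \<open>Injectivity of \<open>z\<close> makes a fibre empty or a copy of \<open>W\<close> over a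
  single \<open>i\<close>, where \<open>q i\<close> is a nonzero constant that preserves
  independence.\<close>

lemma lin_indep_on_class:
  assumes z: "inj_on z I" and q: "\<And>i. i \<in> I \<Longrightarrow> q i \<noteq> 0" and g: "lin_indep_on K W g"
  shows "lin_indep_on K {x\<in>I\<times>W. z (fst x) = z0} (\<lambda>x. q (fst x) * g (snd x))"
proof (cases "z0 \<in> z ` I")
  case True
  then obtain i where i: "i \<in> I" "z0 = z i" by blast
  then have fibre: "{x\<in>I\<times>W. z (fst x) = z0} = Pair i ` W"
    using z by (auto dest: inj_onD)
  show ?thesis
    unfolding fibre lin_indep_on_def
  proof (intro allI impI)
    fix d
    assume d: "\<forall>x\<in>Pair i ` W. d x \<in> K" "(\<Sum>x\<in>Pair i ` W. d x * (q (fst x) * g (snd x))) = 0"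
    have "(\<Sum>x\<in>Pair i ` W. d x * (q (fst x) * g (snd x))) = (\<Sum>p\<in>W. d (i, p) * (q i * g p))"
      by (subst sum.reindex) (auto intro: inj_onI)
    also have "\<dots> = q i * (\<Sum>p\<in>W. d (i, p) * g p)"
      by (simp add: sum_distrib_left mult_ac)
    finally have "(\<Sum>p\<in>W. d (i, p) * g p) = 0" using d(2) q[OF i(1)] by simp
    then have "d (i, p) = 0" if "p \<in> W" for p
      using lin_indep_onD[OF g, of "\<lambda>p. d (i, p)" p] d(1) that by blast
    then show "\<forall>x\<in>Pair i ` W. d x = 0" by blast
  qed
next
  case False
  then have "{x\<in>I\<times>W. z (fst x) = z0} = {}" by auto
  then show ?thesis by (simp only: lin_indep_on_empty)
qed

theorem theorem6p2:
  fixes E F K L :: "'a::field set"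
    and \<sigma> \<theta> :: "'a \<Rightarrow> 'a"
    and h m l r dH drk :: nat
    and C1 C2 :: "'a vec set"
    and f1 f2 :: "'a poly"
    and b s \<delta> :: int
    and k :: "nat \<Rightarrow> int"
    and a \<beta> :: 'a
  \<comment> \<open>the fields\<close>
  assumes subfields: "is_subfield E" "is_subfield F" "is_subfield K" "is_subfield L"
    and degrees: "has_degree K E h" "has_degree F E m"
    and K_F: "K \<inter> F = E"
    and L_def: "L = compositum F K"
    and degrees_L: "has_degree L F h" "has_degree L K m"
    and galois: "cyclic_galois L K"
    and \<sigma>: "\<sigma> \<in> carrier (Gal L K)"
    and \<theta>_def: "\<theta> = restrict \<sigma> F"
    and \<theta>_aut: "\<theta> \<in> carrier (Gal F E)"
    and \<theta>_order: "group.ord (Gal F E) \<theta> = m"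
    and \<theta>_fixed: "{x \<in> F. \<theta> x = x} = E"
  \<comment> \<open>the length of the cyclic code\<close>
    and l_pos: "l > 0"
    and l_roots: "card {x \<in> K. poly (pow_minus_one l) x = 0} = l"
    and l_char: "CHAR('a) = 0 \<or> coprime l CHAR('a)"
    and l_m: "coprime l m"
  \<comment> \<open>the codes\<close>
    and C1: "cyclic_code F l C1" "C1 \<noteq> {0\<^sub>v l}"
    and f1: "generator_poly F l C1 f1" "f1 \<in> polys_over E"
    and dH: "dH = min_distance hamming_weight C1"
    and C2: "skew_cyclic_code F \<theta> m C2" "C2 \<noteq> {0\<^sub>v m}"
    and f2: "skew_generator_poly F \<theta> m C2 f2"
    and drk: "drk = min_distance (rank_weight E) C2"
  \<comment> \<open>the Roos pattern\<close>
    and gcd_s: "gcd (int (l * m)) s = 1"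
    and k_mono: "\<And>i. i < r \<Longrightarrow> k i < k (i + 1)"
    and k_range: "k r - k 0 \<le> \<delta> + int r - 2"
    and a: "a \<in> K" "primitive_root_of_unity l a"
    and \<beta>: "normal_element L K \<sigma> m \<beta>"
    and pattern:
      "{(a powi (b + s * i + k j), (\<sigma> [^]\<^bsub>Gal L K\<^esub> (s * i + k j)) \<beta>)
          |(i::int) (j::nat). 0 \<le> i \<and> i \<le> \<delta> - 2 \<and> j \<le> r}
       \<subseteq> defset_union (roots_of_unity_in K l) (L - {0}) (T_H K l f1) (T_rk L \<sigma> f2)"
  shows "int dH \<ge> \<lceil>real_of_int (\<delta> + int r) / real drk\<rceil> \<and>
         int drk \<ge> \<lceil>real_of_int (\<delta> + int r) / real dH\<rceil>"
proof -
  note E = subfields(1) and F = subfields(2) and K = subfields(3) and L = subfields(4)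
  have E_F: "E \<subseteq> F" and E_K: "E \<subseteq> K" and F_L: "F \<subseteq> L" and K_L: "K \<subseteq> L"
    using degrees degrees_L by auto
  have \<theta>_period: "(\<theta> ^^ m) x = x" if "x \<in> F" for x
  proof -
    interpret group "Gal F E" by (rule group_Gal[OF F E_F])
    have "(\<theta> ^^ m) x = (\<theta> [^]\<^bsub>Gal F E\<^esub> int m) x"
      by (rule Gal_pow[OF F E_F \<theta>_aut that, symmetric])
    also have "\<dots> = x"
      using pow_ord_eq_1[OF \<theta>_aut] by (simp add: int_pow_int \<theta>_order Gal_one[OF that])
    finally show ?thesis .
  qed
  \<comment> \<open>\<open>\<theta>\<close> is \<open>undefined\<close> outside \<open>F\<close>, so
    the induction also records that the iterates stay in \<open>F\<close>.\<close>
  have \<theta>_\<sigma>: "(\<theta> ^^ j) x = (\<sigma> ^^ j) x" if "x \<in> F" for j x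
  proof -
    have "(\<theta> ^^ j) x = (\<sigma> ^^ j) x \<and> (\<theta> ^^ j) x \<in> F"
    proof (induction j)
      case (Suc j)
      then have *: "(\<theta> ^^ j) x = (\<sigma> ^^ j) x" "(\<sigma> ^^ j) x \<in> F" by auto
      moreover have "\<theta> ((\<sigma> ^^ j) x) = \<sigma> ((\<sigma> ^^ j) x)" using *(2) by (simp add: \<theta>_def)
      moreover have "\<theta> ((\<sigma> ^^ j) x) \<in> F" using *(2) by (rule Gal_closed[OF F \<theta>_aut])
      ultimately show ?case by simp
    qed (simp add: that)
    then show ?thesis ..
  qed
  define S where "S = (\<lambda>t::int. \<sigma> [^]\<^bsub>Gal L K\<^esub> t)"
  define T where "T = (\<lambda>t::int. \<theta> [^]\<^bsub>Gal F E\<^esub> t)"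
  have S_\<sigma>: "S (int j) x = (\<sigma> ^^ j) x" if "x \<in> L" for j x
    unfolding S_def by (rule Gal_pow[OF L K_L \<sigma> that])
  \<comment> \<open>\<open>\<sigma>^m\<close> fixes \<open>F\<close> because \<open>\<theta>\<close>
    has order \<open>m\<close>, and it fixes \<open>K\<close>; hence it is the identity on their
    compositum \<open>L\<close>.\<close>
  have \<sigma>_period: "(\<sigma> ^^ m) x = x" if "x \<in> L" for x
  proof -
    interpret group "Gal L K" by (rule group_Gal[OF L K_L])
    have pow: "S (int m) \<in> carrier (Gal L K)"
      unfolding S_def using \<sigma> by (rule int_pow_closed)
    have "S (int m) y = y" if "y \<in> F \<union> K" for y
    proof (cases "y \<in> F")
      case True
      then show ?thesis using F_L \<theta>_\<sigma>[OF True, of m] \<theta>_period[OF True] by (auto simp: S_\<sigma>)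
    next
      case False
      then show ?thesis using that pow by (simp add: Gal_iff[OF L])
    qed
    then have "S (int m) x = x"
      using Gal_fixes_generated_field[OF L pow, of "F \<union> K" x] F_L K_L that L_def by blast
    then show ?thesis by (simp add: S_\<sigma>[OF that])
  qed
  \<comment> \<open>The normal element \<open>\<beta>\<close> shows that every element of
    \<open>L\<close> fixed by \<open>\<sigma>\<close> lies in \<open>K\<close>.\<close>
  have LK: "cyclic_action L K S m"
    unfolding S_def
    using fixed_field_normal_element[OF L K K_L \<sigma> \<sigma>_period \<beta>]
    by (intro cyclic_action_Gal L K K_L \<sigma> \<sigma>_period)
  have FE: "cyclic_action F E T m"
    unfolding T_def
  proof (rule cyclic_action_Gal[OF F E E_F \<theta>_aut \<theta>_period])
    show "x \<in> E" if "x \<in> F" "\<theta> x = x" for x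
      unfolding \<theta>_fixed[symmetric] using that by simp
  qed
  have S_T: "S (int n) x = T (int n) x" if "x \<in> F" for n x
    using that F_L by (auto simp: S_\<sigma> T_def Gal_pow[OF F E_F \<theta>_aut] \<theta>_\<sigma>)
  interpret LK: cyclic_action L K S m by (rule LK)

  obtain u where u: "u \<in> C1" "u \<in> words F l" "u \<noteq> 0\<^sub>v l" "dH = hamming_weight u"
    using min_distance_attained[of F l C1 hamming_weight] C1 dH by (auto simp: cyclic_code_def)
  obtain v where v: "v \<in> C2" "v \<in> words F m" "v \<noteq> 0\<^sub>v m" "drk = rank_weight E v"
    using min_distance_attained[of F m C2 "rank_weight E"] C2 drk by (auto simp: skew_cyclic_code_def)
  have dim_u: "dim_vec u = l" and u_F: "\<And>i. i < l \<Longrightarrow> u $ i \<in> F"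
    and dim_v: "dim_vec v = m" and v_F: "\<And>j. j < m \<Longrightarrow> v $ j \<in> F"
    using u(2) v(2) by (auto simp: words_def)
  define I where "I = {i. i < l \<and> u $ i \<noteq> 0}"
  have I: "finite I" "I \<subseteq> {..<l}" "card I = dH"
    using u(4) by (auto simp: I_def hamming_weight_def dim_u)
  have "I \<noteq> {}"
  proof
    assume "I = {}"
    then have "u = 0\<^sub>v l" by (intro eq_vecI) (auto simp: I_def dim_u)
    then show False using u(3) by simp
  qed
  obtain c e where c: "lin_indep_on E {..<drk} c"
    and e: "\<And>i j. i < drk \<Longrightarrow> j < m \<Longrightarrow> e i j \<in> E"
    and v_eq: "\<And>j. j < m \<Longrightarrow> v $ j = (\<Sum>i<drk. e i j * c i)"
    and c_span: "\<And>i. i < drk \<Longrightarrow> \<exists>f. (\<forall>j<m. f j \<in> E) \<and> c i = (\<Sum>j<m. f j * v $ j)"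
    by (rule rank_factorization[OF E v(4), unfolded dim_v]; rule that; assumption)
  have "drk > 0"
  proof (rule ccontr)
    assume "\<not> drk > 0"
    then have "v = 0\<^sub>v m" by (intro eq_vecI) (auto simp: v_eq dim_v)
    then show False using v(3) by simp
  qed
  have c_F: "c i \<in> F" if i: "i < drk" for i
  proof -
    obtain f where "\<forall>j<m. f j \<in> E" "c i = (\<Sum>j<m. f j * v $ j)" using c_span[OF i] by blast
    then show ?thesis using E_F v_F by (auto intro!: subfield_sum[OF F] subfield_mult[OF F])
  qed
  have c_indep: "lin_indep_on K {..<drk} c"
    by (rule lin_indep_on_linearly_disjoint[OF LK FE degrees_L(1) S_T c_F c])
  have \<beta>_L: "\<beta> \<in> L" using \<beta> by (simp add: normal_element_def)
  define g where "g = (\<lambda>i. \<Sum>j<m. e i j * S (int j) \<beta>)"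
  have \<beta>_indep: "lin_indep_on K {..<m} (\<lambda>j. S (int j) \<beta>)"
  proof -
    define B where "B = map (\<lambda>j. (\<sigma> ^^ j) \<beta>) [0..<m]"
    have "lin_indep_on K {..<length B} (\<lambda>j. B ! j)"
      using \<beta> by (intro independent_imp_lin_indep_on K) (simp add: normal_element_def is_basis_def B_def)
    then show ?thesis by (simp add: lin_indep_on_def B_def S_\<sigma>[OF \<beta>_L])
  qed
  have g_indep: "lin_indep_on K {..<drk} g"
    unfolding g_def
    by (rule lin_indep_on_rank_factor[OF E K E_K c e v_eq c_span \<beta>_indep])
  have e_K: "e i j \<in> K" if "i < drk" "j < m" for i j using e[OF that] E_K by blast
  have g_L: "g i \<in> L" if "i < drk" for i
    unfolding g_def using e_K[OF that] K_L
    by (intro subfield_sum[OF L] subfield_mult[OF L] LK.S_closed \<beta>_L) auto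

  have a0: "a \<noteq> 0" using a(2) by (auto simp: primitive_root_of_unity_def zero_power)
  have coprime_s: "coprime s (int l)" "coprime s (int m)"
    using gcd_s by (simp_all add: coprime_iff_gcd_eq_1[symmetric] coprime_commute)
  have coprime_m: "coprime (int m) (int l)" using l_m by (simp add: coprime_commute)
  have a_inj: "i = j" if "a powi (z * int i) = a powi (z * int j)" "coprime z (int l)" "i \<in> I" "j \<in> I"
    for z i j
    using primitive_root_inj[OF a(2) that(2)] that I(2) by (auto dest: inj_onD)
  \<comment> \<open>The index set pairs the nonzero positions of \<open>u\<close> with the basis of
    the span of the entries of \<open>v\<close>; its size is \<open>dH * drk\<close>.\<close>
  define A where "A = I \<times> {..<drk}"
  define \<zeta> where "\<zeta> = (\<lambda>x::nat \<times> nat. a powi int (fst x))"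
  \<comment> \<open>\<open>q\<close> absorbs the shift \<open>b\<close>, so that both evaluations
    depend on the same exponent \<open>s * i + k j\<close>.\<close>
  define q where "q = (\<lambda>i. u $ i * a powi (b * int i))"
  have q_L: "q i \<in> L" and q_0: "q i \<noteq> 0" if "i \<in> I" for i
    using that u_F[of i] F_L a(1) K_L a0
    by (auto simp: q_def I_def intro!: subfield_mult[OF L] subfield_power_int[OF L])
  have "\<delta> + int r \<le> int (card A)"
  \<comment> \<open>The factor 1 in \<open>1 * g (snd x)\<close> gives this family the shape of
    \<open>lin_indep_on_class\<close> with constant scalars 1.\<close>
  proof (rule LK.roos_bound[where \<zeta> = \<zeta> and g = "\<lambda>x. 1 * g (snd x)" and c = "\<lambda>x. q (fst x) * c (snd x)"
        and s = s and k = k])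
    show "finite A" "A \<noteq> {}" using I \<open>I \<noteq> {}\<close> \<open>drk > 0\<close> by (auto simp: A_def)
    show "\<zeta> x \<in> K - {0}" for x using a(1) a0 by (simp add: \<zeta>_def subfield_power[OF K])
    show "\<zeta> x = \<zeta> y" if "x \<in> A" "y \<in> A" "\<zeta> x ^ m = \<zeta> y ^ m" for x y
    proof -
      have "fst x = fst y"
      proof (rule a_inj)
        show "a powi (int m * int (fst x)) = a powi (int m * int (fst y))"
          using that(3) by (simp add: \<zeta>_def mult.commute[of "int m"] power_int_mult)
      qed (use that coprime_m in \<open>auto simp: A_def\<close>)
      then show ?thesis by (simp add: \<zeta>_def)
    qed
    show "\<zeta> x = \<zeta> y" if "x \<in> A" "y \<in> A" "(\<zeta> x powi s) ^ m = (\<zeta> y powi s) ^ m" for x y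
    proof -
      have "fst x = fst y"
      proof (rule a_inj)
        have *: "a powi (s * int m * z) = ((a powi z) powi s) ^ m" for z
          by (simp add: mult_ac flip: power_int_mult power_int_of_nat)
        show "a powi (s * int m * int (fst x)) = a powi (s * int m * int (fst y))"
          using that(3) unfolding * by (simp add: \<zeta>_def)
      qed (use that coprime_m coprime_s in \<open>auto simp: A_def\<close>)
      then show ?thesis by (simp add: \<zeta>_def)
    qed
    have inj: "inj_on (\<lambda>i. a powi int i) I" using a_inj[of 1] by (auto intro: inj_onI)
    show "lin_indep_on K {x \<in> A. \<zeta> x = z} (\<lambda>x. 1 * g (snd x))" for z
      unfolding A_def \<zeta>_def by (rule lin_indep_on_class[OF inj _ g_indep, where q = "\<lambda>_. 1"]) simp
    show "lin_indep_on K {x \<in> A. \<zeta> x = z} (\<lambda>x. q (fst x) * c (snd x))" for z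
      unfolding A_def \<zeta>_def by (rule lin_indep_on_class[OF inj q_0 c_indep])
    show "1 * g (snd x) \<in> L" if "x \<in> A" for x using that g_L by (auto simp: A_def)
    show "q (fst x) * c (snd x) \<in> L" if "x \<in> A" for x
      using that c_F F_L by (auto simp: A_def intro!: subfield_mult[OF L] q_L)
    show "k i < k (i + 1)" if "i < r" for i using that by (rule k_mono)
    show "k r - k 0 \<le> \<delta> + int r - 2" by (rule k_range)
  next
    fix i :: int and j :: nat
    assume ij: "0 \<le> i" "i \<le> \<delta> - 2" "j \<le> r"
    define t where "t = s * i + k j"
    have "(a powi (b + s * i + k j), S (s * i + k j) \<beta>)
        \<in> defset_union (roots_of_unity_in K l) (L - {0}) (T_H K l f1) (T_rk L \<sigma> f2)"
      using ij by (intro subsetD[OF pattern]) (auto simp: S_def)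
    then have "a powi (b + t) \<in> T_H K l f1 \<or> S t \<beta> \<in> T_rk L \<sigma> f2"
      by (auto simp: defset_union_def t_def add.assoc)
    \<comment> \<open>At every point of the pattern at least one of the two words evaluates to zero,
      so the product always vanishes; expanded over \<open>A\<close> it is the relation that
      \<open>roos_bound\<close> requires.\<close>
    then have zero: "poly (poly_of_word u) (a powi (b + t)) * skew_eval \<sigma> (poly_of_word v) (S t \<beta>) = 0"
      using codeword_root[OF F f1(1) u(1)]
        skew_codeword_root[OF LK F F_L S_\<sigma> \<theta>_\<sigma> f2 v(1)] by auto
    have "poly (poly_of_word u) (a powi (b + t)) = (\<Sum>i<l. u $ i * (a powi (b + t)) ^ i)"
      by (simp add: poly_poly_of_word dim_u)
    also have "\<dots> = (\<Sum>i\<in>I. u $ i * (a powi (b + t)) ^ i)"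
      by (rule sum.mono_neutral_right) (auto simp: I_def)
    also have "\<dots> = (\<Sum>i\<in>I. q i * (a powi int i) powi t)"
    proof (rule sum.cong[OF refl])
      fix i
      have "(a powi (b + t)) ^ i = a powi ((b + t) * int i)"
        by (simp add: power_int_mult)
      also have "\<dots> = a powi (b * int i) * (a powi int i) powi t"
        unfolding power_int_mult[symmetric] using a0 by (simp add: power_int_add[symmetric] algebra_simps)
      finally show "u $ i * (a powi (b + t)) ^ i = q i * (a powi int i) powi t"
        by (simp add: q_def mult.assoc)
    qed
    finally have eval_u: "poly (poly_of_word u) (a powi (b + t)) = (\<Sum>i\<in>I. q i * (a powi int i) powi t)" .
    have "skew_eval \<sigma> (poly_of_word v) (S t \<beta>) = (\<Sum>j<m. v $ j * (\<sigma> ^^ j) (S t \<beta>))"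
      by (simp add: skew_eval_poly_of_word dim_v)
    also have "\<dots> = (\<Sum>j<m. \<Sum>p<drk. c p * (e p j * S t (S (int j) \<beta>)))"
    proof (rule sum.cong[OF refl])
      fix j assume "j \<in> {..<m}"
      \<comment> \<open>Powers of \<open>\<sigma>\<close> commute. With \<open>S t\<close>
        outermost, the coefficients \<open>e p j\<close> from \<open>K\<close> pass through it and
        the sum over \<open>j\<close> becomes \<open>S t (g p)\<close>.\<close>
      moreover have "(\<sigma> ^^ j) (S t \<beta>) = S t (S (int j) \<beta>)"
        by (simp add: S_\<sigma>[symmetric] LK.S_closed LK.S_S \<beta>_L add.commute)
      ultimately show "v $ j * (\<sigma> ^^ j) (S t \<beta>) = (\<Sum>p<drk. c p * (e p j * S t (S (int j) \<beta>)))"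
        by (simp add: v_eq sum_distrib_left sum_distrib_right mult_ac)
    qed
    also have "\<dots> = (\<Sum>p<drk. c p * (\<Sum>j<m. e p j * S t (S (int j) \<beta>)))"
      by (subst sum.swap) (simp add: sum_distrib_left)
    also have "\<dots> = (\<Sum>p<drk. c p * S t (g p))"
    proof (rule sum.cong[OF refl])
      fix p assume p: "p \<in> {..<drk}"
      have "S t (g p) = (\<Sum>j<m. S t (e p j * S (int j) \<beta>))"
        unfolding g_def using e_K[of p] K_L p
        by (intro LK.S_sum subfield_mult[OF L] LK.S_closed \<beta>_L) auto
      also have "\<dots> = (\<Sum>j<m. e p j * S t (S (int j) \<beta>))"
        using e_K[of p] p by (intro sum.cong LK.S_times_K LK.S_closed \<beta>_L) auto
      finally show "c p * (\<Sum>j<m. e p j * S t (S (int j) \<beta>)) = c p * S t (g p)" by simp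
    qed
    finally have eval_v: "skew_eval \<sigma> (poly_of_word v) (S t \<beta>) = (\<Sum>p<drk. c p * S t (g p))" .
    have "0 = (\<Sum>i\<in>I. \<Sum>p<drk. (q i * (a powi int i) powi t) * (c p * S t (g p)))"
      using zero unfolding eval_u eval_v sum_product by simp
    also have "\<dots> = (\<Sum>x\<in>A. q (fst x) * c (snd x) * \<zeta> x powi t * S t (1 * g (snd x)))"
      unfolding A_def sum.cartesian_product
      by (intro sum.cong refl) (auto simp: \<zeta>_def mult_ac)
    finally show "(\<Sum>x\<in>A. q (fst x) * c (snd x) * \<zeta> x powi (s * i + k j) *
        S (s * i + k j) (1 * g (snd x))) = 0"
      by (simp add: t_def)
  qed (use coprime_s in simp)
  then have "\<delta> + int r \<le> int (dH * drk)" by (simp add: A_def I(3) card_cartesian_product)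
  then have "real_of_int (\<delta> + int r) \<le> real_of_int (int (dH * drk))" by (simp only: of_int_le_iff)
  then have product_bound: "real_of_int (\<delta> + int r) \<le> real dH * real drk" by simp
  have "dH > 0" using I \<open>I \<noteq> {}\<close> by (metis card_gt_0_iff)
  \<comment> \<open>Dividing the product bound by either positive distance gives the two claims; the
    ceilings can be added because the distances are integers.\<close>
  with product_bound \<open>drk > 0\<close> show ?thesis
    by (simp add: ceiling_le_iff pos_divide_le_eq mult.commute)
qed

end
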